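(* Let $(a,b)$ be a bounded interval, let $s\ge0$, $k\in\mathbb{N}\cup\{0\}$ and $r>2k+s+1$. Then there is a continuous embedding $H^r_s(a,b)\subset C^k[a,b]$ of $H^r_s(a,b)$ into the Banach space $C^k[a,b]$ of $k$-times continuously differentiable functions in $[a,b]$ with norm $\|v\|_k=\|v\|_\infty+\|v^{(k)}\|_\infty$.
   Context: Let $\omega^s(x)=(x-a)^s(b-x)^s$ and $L^2_s(a,b)=\{\phi:\int_a^b|\phi|^2\omega^s<\infty\}$. On $(-1,1)$ (weight $(1-x^2)^s$) let $C_j^{(s+1/2)}$ be the Gegenbauer polynomials ($C_0^{(\alpha)}=1$, $C_1^{(\alpha)}(x)=2\alpha x$, $C_n^{(\alpha)}(x)=\frac1n[2x(n+\alpha-1)C_{n-1}^{(\alpha)}(x)-(n+2\alpha-2)C_{n-2}^{(\alpha)}(x)]$), and $\tilde C_j^{(s+1/2)}=C_j^{(s+1/2)}/\|C_j^{(s+1/2)}\|_{L^2_s(-1,1)}$. For $v\in L^2_s(-1,1)$ put $v_j=\int_{-1}^1v(x)\tilde C_j^{(s+1/2)}(x)(1-x^2)^s\,dx$. For $r\ge0$, $H^r_s(-1,1)=\{v\in L^2_s(-1,1):\sum_{j\ge0}(1+j^2)^r|v_j|^2<\infty\}$ with norm $\|v\|_{H^r_s}=\big(\sum_{j\ge0}(1+j^2)^r|v_j|^2\big)^{1/2}$. The space $H^r_s(a,b)$ is obtained by the affine change of variables: $v\in H^r_s(a,b)$ iff $\xi\mapsto v\big(a+\frac{(b-a)(\xi+1)}{2}\big)$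 belongs to $H^r_s(-1,1)$, with the transported norm. The embedding means that each element of $H^r_s(a,b)$ agrees a.e. with an element of $C^k[a,b]$. *)

theory Defs
  imports "HOL-Analysis.Analysis"
begin

definition weight :: "real \<Rightarrow> real \<Rightarrow> real \<Rightarrow> real \<Rightarrow> real" where
  "weight a b s x = (x - a) powr s * (b - x) powr s"

text \<open>As usual in Isabelle/HOL, elements of the function spaces are representatives (functions
  on all of \<open>real\<close>); only their values on the interval matter.\<close>

definition L2s :: "real \<Rightarrow> real \<Rightarrow> real \<Rightarrow> (real \<Rightarrow> real) set" where
  "L2s a b s = {\<phi>. \<phi> \<in> borel_measurable (lebesgue_on {a<..<b}) \<and>
     integrable (lebesgue_on {a<..<b}) (\<lambda>x. \<bar>\<phi> x\<bar>\<^sup>2 * weight a b s x)}"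

definition L2s_norm :: "real \<Rightarrow> real \<Rightarrow> real \<Rightarrow> (real \<Rightarrow> real) \<Rightarrow> real" where
  "L2s_norm a b s \<phi> = sqrt (\<integral>x. \<bar>\<phi> x\<bar>\<^sup>2 * weight a b s x \<partial>lebesgue_on {a<..<b})"

fun gegenbauer :: "real \<Rightarrow> nat \<Rightarrow> real \<Rightarrow> real" where
  "gegenbauer \<alpha> 0 x = 1"
| "gegenbauer \<alpha> (Suc 0) x = 2 * \<alpha> * x"
| "gegenbauer \<alpha> (Suc (Suc m)) x =
     (let n = real (Suc (Suc m)) in
      1 / n * (2 * x * (n + \<alpha> - 1) * gegenbauer \<alpha> (Suc m) x
               - (n + 2 * \<alpha> - 2) * gegenbauer \<alpha> m x))"

definition gegenbauer_normalized :: "real \<Rightarrow> nat \<Rightarrow> real \<Rightarrow> real" where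
  "gegenbauer_normalized s j x =
     gegenbauer (s + 1/2) j x / L2s_norm (-1) 1 s (gegenbauer (s + 1/2) j)"

text \<open>On \<open>(-1,1)\<close> the weight \<open>weight (-1) 1 s x\<close> is \<open>(1 - x\<^sup>2) powr s\<close>.\<close>

definition gegenbauer_coeff :: "real \<Rightarrow> (real \<Rightarrow> real) \<Rightarrow> nat \<Rightarrow> real" where
  "gegenbauer_coeff s v j =
     (\<integral>x. v x * gegenbauer_normalized s j x * weight (-1) 1 s x \<partial>lebesgue_on {-1<..<1})"

definition Hrs_ref :: "real \<Rightarrow> real \<Rightarrow> (real \<Rightarrow> real) set" where
  "Hrs_ref r s = {v \<in> L2s (-1) 1 s.
     summable (\<lambda>j. (1 + (real j)\<^sup>2) powr r * \<bar>gegenbauer_coeff s v j\<bar>\<^sup>2)}"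

definition Hrs_ref_norm :: "real \<Rightarrow> real \<Rightarrow> (real \<Rightarrow> real) \<Rightarrow> real" where
  "Hrs_ref_norm r s v =
     sqrt (\<Sum>j. (1 + (real j)\<^sup>2) powr r * \<bar>gegenbauer_coeff s v j\<bar>\<^sup>2)"

definition to_ref :: "real \<Rightarrow> real \<Rightarrow> (real \<Rightarrow> real) \<Rightarrow> (real \<Rightarrow> real)" where
  "to_ref a b v = (\<lambda>\<xi>. v (a + (b - a) * (\<xi> + 1) / 2))"

definition Hrs :: "real \<Rightarrow> real \<Rightarrow> real \<Rightarrow> real \<Rightarrow> (real \<Rightarrow> real) set" where
  "Hrs a b r s = {v. to_ref a b v \<in> Hrs_ref r s}"

definition Hrs_norm :: "real \<Rightarrow> real \<Rightarrow> real \<Rightarrow> real \<Rightarrow> (real \<Rightarrow> real) \<Rightarrow> real" where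
  "Hrs_norm a b r s v = Hrs_ref_norm r s (to_ref a b v)"

text \<open>The derivative relative to \<open>[a,b]\<close>, hence one-sided at the end points.\<close>

definition deriv_on :: "real \<Rightarrow> real \<Rightarrow> (real \<Rightarrow> real) \<Rightarrow> real \<Rightarrow> real" where
  "deriv_on a b f x = vector_derivative f (at x within {a..b})"

definition Ck :: "real \<Rightarrow> real \<Rightarrow> nat \<Rightarrow> (real \<Rightarrow> real) set" where
  "Ck a b k = {w. (\<forall>i<k. (deriv_on a b ^^ i) w differentiable_on {a..b}) \<and>
                  (\<forall>i\<le>k. continuous_on {a..b} ((deriv_on a b ^^ i) w))}"

definition sup_norm_on :: "real \<Rightarrow> real \<Rightarrow> (real \<Rightarrow> real) \<Rightarrow> real" where
  "sup_norm_on a b f = (SUP x\<in>{a..b}. \<bar>f x\<bar>)"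

definition Ck_norm :: "real \<Rightarrow> real \<Rightarrow> nat \<Rightarrow> (real \<Rightarrow> real) \<Rightarrow> real" where
  "Ck_norm a b k w = sup_norm_on a b w + sup_norm_on a b ((deriv_on a b ^^ k) w)"

end

theory Submission
  imports Defs
begin

text \<open>
  Write \<open>\<beta> = s + 1/2\<close>, let \<open>C\<^sub>n\<close> be the Gegenbauer polynomials with parameter \<open>\<beta>\<close> and \<open>h\<^sub>n\<close> their
  squared weighted norms. The embedding sends \<open>v\<close> to the sum of its Gegenbauer series, so the
  \<open>i\<close>-th derivatives of the normalized polynomials have to be bounded uniformly on \<open>[-1,1]\<close>.

  Two facts give this bound. The function \<open>C\<^sub>n\<^sup>2 + (1 - x\<^sup>2) C\<^sub>n'\<^sup>2 / (n (n + 2\<beta>))\<close> increases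
  on \<open>[0,1]\<close> by the Gegenbauer differential equation, so \<open>\<bar>C\<^sub>n\<bar>\<close> is largest at \<open>1\<close>
  (\<open>gegenbauer_le_at_1\<close>). Since \<open>C\<^sub>n'\<close> is \<open>2\<beta>\<close> times the polynomial of degree \<open>n - 1\<close> and parameter
  \<open>\<beta> + 1\<close>, the same holds for all derivatives, and the differential equation at \<open>x = 1\<close> shows that
  each derivative costs at most a factor of order \<open>n\<^sup>2\<close> (\<open>gegenbauer_D_le\<close>). The recurrence gives
  \<open>(n + \<beta>) h\<^sub>n = \<beta> h\<^sub>0 C\<^sub>n(1)\<close> (\<open>gram_diag\<close>), and \<open>C\<^sub>n(1)\<close> is at most of order \<open>n\<close> to the power
  \<open>2\<beta> - 1\<close>. Hence the \<open>i\<close>-th derivative of the \<open>n\<close>-th normalized polynomial is at most of order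
  \<open>n\<close> to the power \<open>2i + s + 1/2\<close> (\<open>gegenbauer_normalized_D_bound\<close>).

  By the Cauchy-Schwarz inequality the coefficients of \<open>v\<close> are summable against this growth for all
  \<open>i \<le> k\<close>, with a sum bounded by the Sobolev norm, exactly when \<open>2 (2k + s + 1/2) - 2r < -1\<close>, that
  is \<open>r > 2k + s + 1\<close> (\<open>Hrs_ref_coeff_summable\<close>). So the series may be differentiated \<open>k\<close> times
  term by term. Its sum \<open>F\<close> has the same coefficients as \<open>v\<close>, and \<open>F = v\<close> almost everywhere because
  an integrable function all of whose moments vanish is zero almost everywhere
  (\<open>gegenbauer_complete\<close>). An affine change of variables transfers everything to \<open>[a,b]\<close>.
\<close>

section \<open>Gegenbauer polynomials: contiguity relations, derivatives and bounds\<close>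

text \<open>The \<open>i\<close>-th derivative of \<open>gegenbauer \<beta> n\<close>, defined by lowering the degree and raising the parameter
  at each step; \<open>gegenbauer_D_has_derivative\<close> justifies the name.\<close>

fun gegenbauer_D :: "nat \<Rightarrow> real \<Rightarrow> nat \<Rightarrow> real \<Rightarrow> real" where
  "gegenbauer_D 0 \<beta> n x = gegenbauer \<beta> n x"
| "gegenbauer_D (Suc i) \<beta> 0 x = 0"
| "gegenbauer_D (Suc i) \<beta> (Suc n) x = 2 * \<beta> * gegenbauer_D i (\<beta> + 1) n x"

declare gegenbauer.simps(3) [simp del] gegenbauer_D.simps(3) [simp del]

lemma gegenbauer_rec:
  "(real n + 2) * gegenbauer \<beta> (Suc (Suc n)) x
     = 2 * (real n + 1 + \<beta>) * x * gegenbauer \<beta> (Suc n) x - (real n + 2 * \<beta>) * gegenbauer \<beta> n x"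
  by (simp add: gegenbauer.simps(3) Let_def field_simps)

text \<open>The recurrence with parameter \<open>\<beta> + 1\<close>, shifted by one degree. It also holds for \<open>n = 0\<close>, where
  the last term is the derivative of a constant.\<close>

lemma gegenbauer_D1_rec:
  "(real n + 1) * gegenbauer_D 1 \<beta> (Suc (Suc n)) x
     = 2 * (real n + 1 + \<beta>) * x * gegenbauer_D 1 \<beta> (Suc n) x
       - (real n + 1 + 2 * \<beta>) * gegenbauer_D 1 \<beta> n x"
proof (cases n)
  case 0
  then show ?thesis by (simp add: gegenbauer_D.simps(3) algebra_simps)
next
  case (Suc m)
  have "(real n + 1) * (2 * \<beta> * gegenbauer (\<beta>+1) (Suc (Suc m)) x)
      = 2 * \<beta> * ((real m + 2) * gegenbauer (\<beta>+1) (Suc (Suc m)) x)"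
    by (simp add: Suc algebra_simps)
  then show ?thesis
    unfolding gegenbauer_rec by (simp add: Suc gegenbauer_D.simps(3) algebra_simps)
qed

text \<open>With primes for derivatives: \<open>x C\<^sub>n' - C\<^sub>m' = n C\<^sub>n\<close> and \<open>C\<^sub>n' - x C\<^sub>m' = (m + 2\<beta>) C\<^sub>m\<close> for
  \<open>n = m + 1\<close>. The proof is purely algebraic and does not use that \<open>gegenbauer_D 1\<close> is a derivative;
  that fact and the differential equation are consequences.\<close>

lemma gegenbauer_contiguous:
  "x * gegenbauer_D 1 \<beta> (Suc n) x - gegenbauer_D 1 \<beta> n x
      = (real n + 1) * gegenbauer \<beta> (Suc n) x \<and>
   gegenbauer_D 1 \<beta> (Suc n) x - x * gegenbauer_D 1 \<beta> n x
      = (real n + 2 * \<beta>) * gegenbauer \<beta> n x"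
proof (induction n)
  case 0
  then show ?case by (simp add: gegenbauer_D.simps(3))
next
  case (Suc n)
  define D0 D1 D2 where "D0 = gegenbauer_D 1 \<beta> n x" and "D1 = gegenbauer_D 1 \<beta> (Suc n) x"
    and "D2 = gegenbauer_D 1 \<beta> (Suc (Suc n)) x"
  define C0 C1 C2 where "C0 = gegenbauer \<beta> n x" and "C1 = gegenbauer \<beta> (Suc n) x"
    and "C2 = gegenbauer \<beta> (Suc (Suc n)) x"
  define N where "N = real n"
  note d = D0_def D1_def D2_def C0_def C1_def C2_def N_def
  have A: "x * D1 - D0 = (N + 1) * C1" and B: "D1 - x * D0 = (N + 2 * \<beta>) * C0"
    using Suc by (simp_all add: d)
  have R: "(N + 2) * C2 = 2 * (N + 1 + \<beta>) * x * C1 - (N + 2 * \<beta>) * C0"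
    unfolding d by (rule gegenbauer_rec)
  have RD: "(N + 1) * D2 = 2 * (N + 1 + \<beta>) * x * D1 - (N + 1 + 2 * \<beta>) * D0"
    unfolding d by (rule gegenbauer_D1_rec)
  have "(N + 1) * (D2 - x * D1) = (N + 1) * ((N + 1 + 2 * \<beta>) * C1)"
    using A RD by algebra
  moreover have "N + 1 \<noteq> 0" by (simp add: N_def add_nonneg_eq_0_iff)
  ultimately have B': "D2 - x * D1 = (N + 1 + 2 * \<beta>) * C1" by simp
  have A': "x * D2 - D1 = (N + 2) * C2"
    using A B B' R by algebra
  show ?case using A' B' unfolding d by (simp add: algebra_simps)
qed

lemmas gegenbauer_contiguous1 = gegenbauer_contiguous[THEN conjunct1]
lemmas gegenbauer_contiguous2 = gegenbauer_contiguous[THEN conjunct2]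

lemma gegenbauer_has_derivative:
  "(gegenbauer \<beta> n has_real_derivative gegenbauer_D 1 \<beta> n x) (at x within A)"
proof -
  have "(gegenbauer \<beta> n has_real_derivative gegenbauer_D 1 \<beta> n x) (at x within A) \<and>
    (gegenbauer \<beta> (Suc n) has_real_derivative gegenbauer_D 1 \<beta> (Suc n) x) (at x within A)"
  proof (induction n)
    case 0
    have [simp]: "gegenbauer \<beta> 0 = (\<lambda>x. 1)" "gegenbauer \<beta> (Suc 0) = (\<lambda>x. 2 * \<beta> * x)"
      by auto
    show ?case by (auto intro!: derivative_eq_intros simp: gegenbauer_D.simps(3))
  next
    case (Suc n)
    note [derivative_intros] = Suc[THEN conjunct1] Suc[THEN conjunct2]
    have eq: "gegenbauer \<beta> (Suc (Suc n)) = (\<lambda>x. (2 * (real n + 1 + \<beta>) * x * gegenbauer \<beta> (Suc n) x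
       - (real n + 2 * \<beta>) * gegenbauer \<beta> n x) / (real n + 2))"
      unfolding gegenbauer_rec[symmetric] by (auto simp: fun_eq_iff)
    have "(gegenbauer \<beta> (Suc (Suc n)) has_real_derivative
        (2 * (real n + 1 + \<beta>) * (gegenbauer \<beta> (Suc n) x + x * gegenbauer_D 1 \<beta> (Suc n) x)
          - (real n + 2 * \<beta>) * gegenbauer_D 1 \<beta> n x) / (real n + 2)) (at x within A)"
      unfolding eq
      by (rule DERIV_cdivide) (auto intro!: derivative_eq_intros simp: algebra_simps)
    also have "(2 * (real n + 1 + \<beta>) * (gegenbauer \<beta> (Suc n) x + x * gegenbauer_D 1 \<beta> (Suc n) x)
          - (real n + 2 * \<beta>) * gegenbauer_D 1 \<beta> n x) = (real n + 2) * gegenbauer_D 1 \<beta> (Suc (Suc n)) x"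
    proof -
      have "gegenbauer_D 1 \<beta> (Suc (Suc n)) x - x * gegenbauer_D 1 \<beta> (Suc n) x
          = (real n + 1 + 2 * \<beta>) * gegenbauer \<beta> (Suc n) x"
        using gegenbauer_contiguous2[of \<beta> "Suc n" x] by (simp add: algebra_simps)
      with gegenbauer_contiguous1[of x \<beta> n] show ?thesis by algebra
    qed
    finally show ?case using Suc by simp
  qed
  then show ?thesis by blast
qed

lemma gegenbauer_D_has_derivative:
  "(gegenbauer_D i \<beta> n has_real_derivative gegenbauer_D (Suc i) \<beta> n x) (at x within A)"
proof (induction i arbitrary: \<beta> n)
  case 0
  have "gegenbauer_D 0 \<beta> n = gegenbauer \<beta> n" by auto
  then show ?case using gegenbauer_has_derivative[of \<beta> n x A] by simp
next
  case (Suc i)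
  show ?case
  proof (cases n)
    case 0
    have "gegenbauer_D (Suc i) \<beta> 0 = (\<lambda>x. 0)" by auto
    then show ?thesis using 0 by simp
  next
    case (Suc m)
    have "gegenbauer_D (Suc i) \<beta> (Suc m) = (\<lambda>x. 2 * \<beta> * gegenbauer_D i (\<beta>+1) m x)"
      by (auto simp: gegenbauer_D.simps(3))
    then show ?thesis using Suc.IH Suc by (auto intro!: derivative_eq_intros simp: gegenbauer_D.simps(3))
  qed
qed

lemma continuous_on_gegenbauer_D: "continuous_on A (gegenbauer_D i \<beta> n)"
  using gegenbauer_D_has_derivative by (rule DERIV_continuous_on)

lemma continuous_on_gegenbauer: "continuous_on A (gegenbauer \<beta> n)"
  using gegenbauer_has_derivative by (rule DERIV_continuous_on)

lemma gegenbauer_lowering: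
  "(1 - x\<^sup>2) * gegenbauer_D 1 \<beta> (Suc n) x
     = (real n + 2 * \<beta>) * gegenbauer \<beta> n x - (real n + 1) * x * gegenbauer \<beta> (Suc n) x"
  using gegenbauer_contiguous1[of x \<beta> n] gegenbauer_contiguous2[of \<beta> n x] by algebra

lemma gegenbauer_ode:
  "(1 - x\<^sup>2) * gegenbauer_D 2 \<beta> n x
     = (2 * \<beta> + 1) * x * gegenbauer_D 1 \<beta> n x - real n * (real n + 2 * \<beta>) * gegenbauer \<beta> n x"
proof (cases n)
  case 0
  then show ?thesis by (simp add: numeral_2_eq_2)
next
  case (Suc m)
  show ?thesis
  proof (cases m)
    case 0
    then show ?thesis using Suc by (simp add: numeral_2_eq_2 gegenbauer_D.simps(3) algebra_simps)
  next
    case (Suc l)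
    have eq: "gegenbauer_D 2 \<beta> n x = 2 * \<beta> * gegenbauer_D 1 (\<beta> + 1) m x"
      "gegenbauer_D 1 \<beta> n x = 2 * \<beta> * gegenbauer (\<beta> + 1) m x"
      "gegenbauer_D 1 \<beta> m x = 2 * \<beta> * gegenbauer (\<beta> + 1) l x"
      using Suc \<open>n = Suc m\<close> by (simp_all add: numeral_2_eq_2 gegenbauer_D.simps(3))
    show ?thesis
      using gegenbauer_lowering[of x "\<beta> + 1" l] gegenbauer_contiguous1[of x \<beta> m] eq
      unfolding \<open>n = Suc m\<close> Suc by (simp add: algebra_simps) algebra
  qed
qed

lemma gegenbauer_at_1_Suc:
  "(real n + 1) * gegenbauer \<beta> (Suc n) 1 = (real n + 2 * \<beta>) * gegenbauer \<beta> n 1"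
  using gegenbauer_contiguous1[of 1 \<beta> n] gegenbauer_contiguous2[of \<beta> n 1] by simp

lemma gegenbauer_at_1_pos: "\<beta> > 0 \<Longrightarrow> gegenbauer \<beta> n 1 > 0"
proof (induction n)
  case (Suc n)
  then have "(real n + 1) * gegenbauer \<beta> (Suc n) 1 > 0"
    unfolding gegenbauer_at_1_Suc by simp
  then show ?case by (simp add: zero_less_mult_iff)
qed simp

lemma gegenbauer_minus: "gegenbauer \<beta> n (- x) = (-1) ^ n * gegenbauer \<beta> n x"
proof (induction \<beta> n x rule: gegenbauer.induct)
  case (3 \<beta> m x)
  then show ?case by (simp add: gegenbauer.simps(3) Let_def algebra_simps)
qed auto

text \<open>Sonin's argument: the auxiliary function \<open>f\<close> in the proof dominates the square of the polynomial,
  agrees with it at \<open>1\<close>, and has derivative \<open>4 \<beta> y (C\<^sub>n'(y))\<^sup>2 / (n (n + 2\<beta>))\<close>. Negative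
  arguments are reduced to positive ones by parity.\<close>

lemma gegenbauer_le_at_1:
  assumes "\<beta> > 0" "\<bar>x\<bar> \<le> 1"
  shows "\<bar>gegenbauer \<beta> n x\<bar> \<le> gegenbauer \<beta> n 1"
proof (cases n)
  case 0
  then show ?thesis by simp
next
  case (Suc m)
  define l where "l = real n * (real n + 2 * \<beta>)"
  have l: "l > 0" using assms Suc by (auto simp: l_def)
  have abs: "\<bar>gegenbauer \<beta> n x\<bar> = \<bar>gegenbauer \<beta> n \<bar>x\<bar>\<bar>"
    by (auto simp: abs_if[of x] gegenbauer_minus abs_mult)
  define f where "f = (\<lambda>y. (gegenbauer_D 0 \<beta> n y)\<^sup>2 + (1 - y\<^sup>2) * (gegenbauer_D 1 \<beta> n y)\<^sup>2 / l)"
  have "f \<bar>x\<bar> \<le> f 1"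
  proof (rule DERIV_nonneg_imp_nondecreasing[where f = f])
    fix y assume y: "\<bar>x\<bar> \<le> y" "y \<le> 1"
    define c d e where "c = gegenbauer \<beta> n y" and "d = gegenbauer_D 1 \<beta> n y"
      and "e = gegenbauer_D 2 \<beta> n y"
    have ode: "(1 - y\<^sup>2) * e = (2 * \<beta> + 1) * y * d - l * c"
      unfolding c_def d_def e_def l_def by (rule gegenbauer_ode)
    have "(f has_real_derivative 2 * c * d + (- 2 * y * d\<^sup>2 + (1 - y\<^sup>2) * (2 * d * e)) / l) (at y)"
      unfolding f_def c_def d_def e_def numeral_2_eq_2
      using l by (auto intro!: derivative_eq_intros gegenbauer_D_has_derivative gegenbauer_has_derivative simp: field_simps power2_eq_square)
    also have "(- 2 * y * d\<^sup>2 + (1 - y\<^sup>2) * (2 * d * e)) = 4 * \<beta> * y * d\<^sup>2 - l * (2 * c * d)"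
      using ode by algebra
    also have "2 * c * d + (4 * \<beta> * y * d\<^sup>2 - l * (2 * c * d)) / l = 4 * \<beta> * y * d\<^sup>2 / l"
      using l by (simp add: field_simps)
    finally show "\<exists>z. (f has_real_derivative z) (at y) \<and> 0 \<le> z"
      using l y assms by (intro exI conjI) auto
  qed (use assms in auto)
  then have "(gegenbauer \<beta> n \<bar>x\<bar>)\<^sup>2 + (1 - x\<^sup>2) * (gegenbauer_D 1 \<beta> n \<bar>x\<bar>)\<^sup>2 / l \<le> (gegenbauer \<beta> n 1)\<^sup>2"
    by (simp add: f_def)
  moreover have "(1 - x\<^sup>2) * (gegenbauer_D 1 \<beta> n \<bar>x\<bar>)\<^sup>2 / l \<ge> 0"
    using l assms by (simp add: abs_square_le_1)
  ultimately have "(gegenbauer \<beta> n \<bar>x\<bar>)\<^sup>2 \<le> (gegenbauer \<beta> n 1)\<^sup>2"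
    by linarith
  then have "\<bar>gegenbauer \<beta> n \<bar>x\<bar>\<bar> \<le> \<bar>gegenbauer \<beta> n 1\<bar>"
    by (simp add: abs_le_square_iff)
  then show ?thesis using abs gegenbauer_at_1_pos[OF assms(1), of n] by linarith
qed

text \<open>Induction on \<open>i\<close> with varying \<open>\<beta>\<close> and \<open>n\<close>: passing from \<open>(\<beta>, n)\<close> to \<open>(\<beta> + 1, n - 1)\<close> and from \<open>i\<close> to
  \<open>i - 1\<close> leaves the base \<open>n + 2\<beta> + i\<close> unchanged, and by the differential equation at \<open>1\<close> the first
  derivative at \<open>1\<close> is at most the value at \<open>1\<close> times the square of this base.\<close>

lemma gegenbauer_D_le:
  assumes "\<beta> > 0" "\<bar>x\<bar> \<le> 1"
  shows "\<bar>gegenbauer_D i \<beta> n x\<bar> \<le> (real n + 2 * \<beta> + real i) ^ (2 * i) * gegenbauer \<beta> n 1"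
  using assms
proof (induction i arbitrary: \<beta> n)
  case 0
  then show ?case using gegenbauer_le_at_1 by simp
next
  case (Suc i)
  show ?case
  proof (cases n)
    case 0
    then show ?thesis using Suc by simp
  next
    case (Suc m)
    let ?q = "real n + 2 * \<beta> + real (Suc i)"
    have D1: "(2 * \<beta> + 1) * gegenbauer_D 1 \<beta> n 1 = real n * (real n + 2 * \<beta>) * gegenbauer \<beta> n 1"
      using gegenbauer_ode[of 1 \<beta> n] by simp
    have pos: "gegenbauer \<beta> n 1 > 0" using Suc.prems gegenbauer_at_1_pos by blast
    have "gegenbauer_D 1 \<beta> n 1 \<ge> 0"
      using gegenbauer_at_1_pos[of "\<beta>+1" m] Suc.prems by (simp add: Suc gegenbauer_D.simps(3))
    then have "1 * gegenbauer_D 1 \<beta> n 1 \<le> (2 * \<beta> + 1) * gegenbauer_D 1 \<beta> n 1"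
      using Suc.prems by (intro mult_right_mono) auto
    also have "\<dots> \<le> ?q ^ 2 * gegenbauer \<beta> n 1"
      unfolding D1 power2_eq_square using Suc.prems pos by (intro mult_right_mono mult_mono) auto
    finally have D1_le: "2 * \<beta> * gegenbauer (\<beta> + 1) m 1 \<le> ?q ^ 2 * gegenbauer \<beta> n 1"
      by (simp add: Suc gegenbauer_D.simps(3))
    have "\<bar>gegenbauer_D (Suc i) \<beta> n x\<bar> = 2 * \<beta> * \<bar>gegenbauer_D i (\<beta> + 1) m x\<bar>"
      using Suc.prems by (simp add: Suc gegenbauer_D.simps(3) abs_mult)
    also have "\<dots> \<le> 2 * \<beta> * ((real m + 2 * (\<beta> + 1) + real i) ^ (2 * i) * gegenbauer (\<beta> + 1) m 1)"
      using Suc.prems by (intro mult_left_mono Suc.IH) auto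
    also have "real m + 2 * (\<beta> + 1) + real i = ?q" by (simp add: Suc)
    also have "2 * \<beta> * (?q ^ (2 * i) * gegenbauer (\<beta> + 1) m 1)
        = ?q ^ (2 * i) * (2 * \<beta> * gegenbauer (\<beta> + 1) m 1)" by simp
    also have "\<dots> \<le> ?q ^ (2 * i) * (?q ^ 2 * gegenbauer \<beta> n 1)"
      using D1_le by (intro mult_left_mono) (auto simp: power_mult)
    also have "\<dots> = ?q ^ (2 * Suc i) * gegenbauer \<beta> n 1" by (simp add: power2_eq_square)
    finally show ?thesis .
  qed
qed

text \<open>The quotient of consecutive values at \<open>1\<close> is \<open>1 + p/(N + 1)\<close> with \<open>p = 2\<beta> - 1\<close>, and it is
  at most \<open>((N + 1)/N)\<close> to the power \<open>p\<close>, because \<open>ln ((N + 1)/N) \<ge> 1/(N + 1)\<close>.\<close>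

lemma gegenbauer_at_1_le:
  assumes "\<beta> \<ge> 1/2"
  shows "gegenbauer \<beta> (Suc n) 1 \<le> 2 * \<beta> * (real n + 1) powr (2 * \<beta> - 1)"
proof (induction n)
  case 0
  then show ?case by simp
next
  case (Suc n)
  define p where "p = 2 * \<beta> - 1"
  have p: "p \<ge> 0" using assms by (simp add: p_def)
  define N where "N = real n + 1"
  have N: "N > 0" by (simp add: N_def)
  have "- (1 / (N + 1)) \<ge> ln (1 - 1 / (N + 1))"
    using N by (intro order.trans[OF ln_le_minus_one]) auto
  also have "1 - 1 / (N + 1) = N / (N + 1)" using N by (simp add: field_simps)
  also have "ln (N / (N + 1)) = ln N - ln (N + 1)" using N by (simp add: ln_div)
  finally have l: "1 / (N + 1) \<le> ln (N + 1) - ln N" by simp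
  have "1 + p / (N + 1) \<le> exp (p * (1 / (N + 1)))"
    using exp_ge_add_one_self[of "p / (N + 1)"] by simp
  also have "\<dots> \<le> exp (p * (ln (N + 1) - ln N))" using l p by (intro exp_mono mult_left_mono) auto
  also have "\<dots> = ((N + 1) powr p) / (N powr p)"
    using N by (simp add: powr_def exp_diff algebra_simps)
  finally have r: "(1 + p / (N + 1)) * N powr p \<le> (N + 1) powr p"
    using N by (simp add: field_simps)
  have "(N + 1) * gegenbauer \<beta> (Suc (Suc n)) 1 = (N + 1 + p) * gegenbauer \<beta> (Suc n) 1"
    using gegenbauer_at_1_Suc[of "Suc n" \<beta>] by (simp add: N_def p_def algebra_simps)
  then have "gegenbauer \<beta> (Suc (Suc n)) 1 = (1 + p / (N + 1)) * gegenbauer \<beta> (Suc n) 1"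
    using N by (simp add: field_simps)
  also have "\<dots> \<le> (1 + p / (N + 1)) * (2 * \<beta> * N powr p)"
    using Suc N p by (intro mult_left_mono) (auto simp: N_def p_def)
  also have "\<dots> = 2 * \<beta> * ((1 + p / (N + 1)) * N powr p)" by simp
  also have "\<dots> \<le> 2 * \<beta> * (N + 1) powr p" using r assms by (intro mult_left_mono) auto
  finally show ?case by (simp add: N_def p_def algebra_simps)
qed

section \<open>Orthogonality, norms and completeness\<close>

text \<open>Lebesgue measure on the open reference interval. Positivity and continuity of the weight hold
  only there: at the end points it is zero even for \<open>s = 0\<close>, as \<open>0 powr 0 = 0\<close>.\<close>

abbreviation IM :: "real measure" where "IM \<equiv> lebesgue_on {-1<..<1}"

lemma continuous_measurable_IM:
  fixes f :: "real \<Rightarrow> real"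
  shows "continuous_on {-1<..<1} f \<Longrightarrow> f \<in> borel_measurable IM"
  by (rule continuous_imp_measurable_on_sets_lebesgue) auto

lemma finite_measure_IM: "finite_measure IM"
  by (rule finite_measure_lebesgue_on) (metis box_real(1) lmeasurable_box)

lemma integrable_mult_continuous:
  fixes p :: "real \<Rightarrow> real"
  assumes "integrable IM g" "continuous_on {-1..1} p"
  shows "integrable IM (\<lambda>x. g x * p x)"
proof -
  have "compact (p ` {-1..1})"
    using assms(2) compact_Icc by (rule compact_continuous_image)
  then have "bounded (p ` {-1..1})" by (rule compact_imp_bounded)
  then obtain B where B: "\<And>x. x \<in> {-1..1} \<Longrightarrow> \<bar>p x\<bar> \<le> B"
    unfolding bounded_iff by (metis imageI real_norm_def)
  have p: "p \<in> borel_measurable IM"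
    by (intro continuous_measurable_IM continuous_on_subset[OF assms(2)]) auto
  show ?thesis
  proof (rule Bochner_Integration.integrable_bound[of _ "\<lambda>x. B * g x"])
    show "integrable IM (\<lambda>x. B * g x)" using assms by simp
    show "(\<lambda>x. g x * p x) \<in> borel_measurable IM"
      using p borel_measurable_integrable[OF assms(1)] by simp
    show "AE x in IM. norm (g x * p x) \<le> norm (B * g x)"
    proof (rule AE_I2)
      fix x assume "x \<in> space IM"
      then have "\<bar>p x\<bar> \<le> \<bar>B\<bar>" using B[of x] by (force simp: space_restrict_space)
      then show "norm (g x * p x) \<le> norm (B * g x)"
        by (simp add: abs_mult mult.commute[of "\<bar>g x\<bar>"] mult_right_mono)
    qed
  qed
qed

lemma weight_pos: "-1 < x \<Longrightarrow> x < 1 \<Longrightarrow> weight (-1) 1 s x > 0"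
  by (simp add: weight_def)

lemma continuous_on_weight: "continuous_on {-1<..<1} (weight (-1) 1 s)"
  unfolding weight_def[abs_def] by (intro continuous_intros) auto

lemma integrable_weight:
  assumes "s \<ge> 0"
  shows "integrable IM (weight (-1) 1 s)"
proof (rule finite_measure.integrable_const_bound[OF finite_measure_IM, where B = 1])
  show "AE x in IM. norm (weight (-1) 1 s x) \<le> 1"
  proof (rule AE_I2)
    fix x assume "x \<in> space IM"
    then have x: "-1 < x" "x < 1" by (auto simp: space_restrict_space)
    have "weight (-1) 1 s x = ((x + 1) * (1 - x)) powr s"
      using x by (simp add: weight_def powr_mult)
    also have "(x + 1) * (1 - x) = 1 - x\<^sup>2" by (simp add: algebra_simps power2_eq_square)
    also have "(1 - x\<^sup>2) powr s \<le> 1"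
      using x assms by (intro powr_le1) (auto simp: abs_square_le_1)
    finally show "norm (weight (-1) 1 s x) \<le> 1" using weight_pos[OF x, of s] by simp
  qed
qed (rule continuous_measurable_IM[OF continuous_on_weight])

lemma integrable_weight_mult:
  "s \<ge> 0 \<Longrightarrow> continuous_on {-1..1} p \<Longrightarrow> integrable IM (\<lambda>x. p x * weight (-1) 1 s x)"
  using integrable_mult_continuous[OF integrable_weight, of s p] by (simp add: mult.commute)

lemma integrable_L2s_weight:
  assumes "s \<ge> 0" "v \<in> L2s (-1) 1 s"
  shows "integrable IM (\<lambda>x. v x * weight (-1) 1 s x)"
proof (rule Bochner_Integration.integrable_bound)
  let ?W = "weight (-1) 1 s"
  show "integrable IM (\<lambda>x. \<bar>v x\<bar>\<^sup>2 * ?W x + ?W x)"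
    using assms integrable_weight by (auto simp: L2s_def)
  show "(\<lambda>x. v x * ?W x) \<in> borel_measurable IM"
    using assms continuous_measurable_IM[OF continuous_on_weight] by (auto simp: L2s_def)
  show "AE x in IM. norm (v x * ?W x) \<le> norm (\<bar>v x\<bar>\<^sup>2 * ?W x + ?W x)"
  proof (rule AE_I2)
    fix x assume "x \<in> space IM"
    then have W: "?W x > 0" using weight_pos by (auto simp: space_restrict_space)
    have "0 \<le> (\<bar>v x\<bar> - 1)\<^sup>2" by simp
    then have "\<bar>v x\<bar> \<le> \<bar>v x\<bar>\<^sup>2 + 1" unfolding power2_diff by simp
    then have "\<bar>v x\<bar> * ?W x \<le> (\<bar>v x\<bar>\<^sup>2 + 1) * ?W x" using W by (intro mult_right_mono) auto
    moreover have "norm (v x * ?W x) = \<bar>v x\<bar> * ?W x" using W by (simp add: abs_mult)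
    moreover have "norm (\<bar>v x\<bar>\<^sup>2 * ?W x + ?W x) = (\<bar>v x\<bar>\<^sup>2 + 1) * ?W x"
      using W by (simp add: algebra_simps)
    ultimately show "norm (v x * ?W x) \<le> norm (\<bar>v x\<bar>\<^sup>2 * ?W x + ?W x)" by simp
  qed
qed

lemma integrable_L2s_mult:
  assumes "s \<ge> 0" "v \<in> L2s (-1) 1 s" "continuous_on {-1..1} p"
  shows "integrable IM (\<lambda>x. v x * p x * weight (-1) 1 s x)"
  using integrable_mult_continuous[OF integrable_L2s_weight[OF assms(1,2)] assms(3)]
  by (simp add: mult_ac)

text \<open>The weighted inner products of the Gegenbauer polynomials with parameter \<open>s + 1/2\<close>.\<close>

definition gram :: "real \<Rightarrow> nat \<Rightarrow> nat \<Rightarrow> real" where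
  "gram s m n = (\<integral>x. gegenbauer (s + 1/2) m x * gegenbauer (s + 1/2) n x * weight (-1) 1 s x \<partial>IM)"

text \<open>The Sturm-Liouville argument: \<open>F = (1 - x\<^sup>2) w (C\<^sub>m' C\<^sub>n - C\<^sub>m C\<^sub>n')\<close>, with \<open>w\<close> the weight, vanishes
  at the end points and has derivative \<open>(l n - l m) C\<^sub>m C\<^sub>n w\<close>, where \<open>l n\<close> is the eigenvalue
  \<open>n (n + 2\<beta>)\<close>.\<close>

lemma gram_orthogonal:
  assumes "s \<ge> 0" "m \<noteq> n"
  shows "gram s m n = 0"
proof -
  define \<beta> where "\<beta> = s + 1/2"
  define l where "l = (\<lambda>n. real n * (real n + 2 * \<beta>))"
  let ?C = "gegenbauer \<beta>" and ?D = "gegenbauer_D 1 \<beta>" and ?E = "gegenbauer_D 2 \<beta>"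
    and ?W = "weight (-1) 1 s"
  define f where "f = (\<lambda>x. (l n - l m) * (?C m x * ?C n x * ?W x))"
  define F where "F = (\<lambda>x. ((x + 1) powr (s + 1) * (1 - x) powr (s + 1)) * (?D m x * ?C n x - ?C m x * ?D n x))"
  have "(f has_integral (F 1 - F (-1))) {-1..1}"
  proof (rule fundamental_theorem_of_calculus_interior)
    show "continuous_on {-1..1} F"
      unfolding F_def using assms
      by (intro continuous_intros continuous_on_powr' continuous_on_gegenbauer_D continuous_on_gegenbauer) auto
    fix x :: real assume "x \<in> {-1<..<1}"
    then have x: "-1 < x" "x < 1" by auto
    have D: "(?D k has_real_derivative ?E k x) (at x)" for k
      using gegenbauer_D_has_derivative[of 1 \<beta> k x UNIV] by (simp add: numeral_2_eq_2)
    note C = gegenbauer_has_derivative[where A = UNIV]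
    have p: "((\<lambda>x. (x + 1) powr (s + 1)) has_real_derivative (s + 1) * (x + 1) powr s) (at x)"
      using x by (auto intro!: derivative_eq_intros)
    have q: "((\<lambda>x. (1 - x) powr (s + 1)) has_real_derivative - ((s + 1) * (1 - x) powr s)) (at x)"
      using x by (auto intro!: derivative_eq_intros)
    have W: "?W x = (x + 1) powr s * (1 - x) powr s" by (simp add: weight_def)
    have pq: "(x + 1) powr (s + 1) = (x + 1) * (x + 1) powr s" "(1 - x) powr (s + 1) = (1 - x) * (1 - x) powr s"
      using x by (simp_all add: powr_add)
    have "(F has_real_derivative
       ((s + 1) * (x + 1) powr s * (1 - x) powr (s + 1) - (s + 1) * (1 - x) powr s * (x + 1) powr (s + 1))
          * (?D m x * ?C n x - ?C m x * ?D n x)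
       + ((x + 1) powr (s + 1) * (1 - x) powr (s + 1)) * (?E m x * ?C n x - ?C m x * ?E n x)) (at x)"
      unfolding F_def
      by (rule DERIV_cong[OF DERIV_mult[OF DERIV_mult[OF p q] DERIV_diff[OF DERIV_mult[OF D C] DERIV_mult[OF C D]]]])
         (simp add: algebra_simps)
    also have "((s + 1) * (x + 1) powr s * (1 - x) powr (s + 1) - (s + 1) * (1 - x) powr s * (x + 1) powr (s + 1))
          * (?D m x * ?C n x - ?C m x * ?D n x)
       + ((x + 1) powr (s + 1) * (1 - x) powr (s + 1)) * (?E m x * ?C n x - ?C m x * ?E n x) = 
       ?W x * (- (2 * \<beta> + 1) * x * (?D m x * ?C n x - ?C m x * ?D n x)
        + (((1 - x\<^sup>2) * ?E m x) * ?C n x - ?C m x * ((1 - x\<^sup>2) * ?E n x)))"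
      unfolding pq W \<beta>_def by (simp add: algebra_simps power2_eq_square)
    also have "\<dots> = f x"
      unfolding gegenbauer_ode f_def l_def by (simp add: algebra_simps)
    finally show "(F has_vector_derivative f x) (at x)"
      by (simp add: has_real_derivative_iff_has_vector_derivative)
  qed simp
  moreover have "F 1 = 0" "F (-1) = 0" using assms by (auto simp: F_def)
  ultimately have "(f has_integral 0) {-1<..<1}" by (simp add: has_integral_Icc_iff_Ioo)
  moreover have int: "integrable IM (\<lambda>x. ?C m x * ?C n x * ?W x)"
    by (intro integrable_weight_mult assms continuous_intros continuous_on_gegenbauer)
  then have "integrable IM f" unfolding f_def by simp
  ultimately have "integral\<^sup>L IM f = 0"
    by (metis integral_unique lebesgue_integral_eq_integral lmeasurable_box fmeasurableD box_real(1))
  then have "(l n - l m) * gram s m n = 0" by (simp add: f_def gram_def \<beta>_def)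
  moreover have "l n \<noteq> l m"
  proof -
    have "l i < l j" if "i < j" for i j
      unfolding l_def using that assms by (intro mult_strict_mono') (auto simp: \<beta>_def)
    then show ?thesis using assms(2) by (metis less_irrefl linorder_neqE_nat)
  qed
  ultimately show ?thesis by simp
qed

lemma gram_0_pos:
  assumes "s \<ge> 0"
  shows "gram s 0 0 > 0"
proof -
  have W: "AE x in IM. weight (-1) 1 s x > 0"
    by (rule AE_I2) (auto simp: space_restrict_space intro: weight_pos)
  have "gram s 0 0 = (\<integral>x. weight (-1) 1 s x \<partial>IM)" by (simp add: gram_def)
  moreover have "\<dots> \<noteq> 0"
  proof
    assume "(\<integral>x. weight (-1) 1 s x \<partial>IM) = 0"
    then have "AE x in IM. weight (-1) 1 s x = 0"
      using W by (subst (asm) integral_nonneg_eq_0_iff_AE[OF integrable_weight[OF assms]]) auto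
    with W have "AE x in IM. False" by eventually_elim auto
    then have "emeasure IM (space IM) = 0"
      by (subst (asm) AE_iff_measurable[OF sets.top]) auto
    then have "emeasure lebesgue {-1<..<1::real} = 0"
      by (simp add: emeasure_restrict_space space_restrict_space)
    then show False by simp
  qed
  moreover have "(\<integral>x. weight (-1) 1 s x \<partial>IM) \<ge> 0"
    using W by (intro integral_nonneg_AE) auto
  ultimately show ?thesis by linarith
qed

text \<open>Integrating the recurrence against two neighbouring polynomials expresses \<open>K\<close>, the integral of
  \<open>x C\<^sub>n C\<^sub>m w\<close> with \<open>m = n + 1\<close>, by the squared norm of \<open>C\<^sub>n\<close> (\<open>up\<close>) and by that of \<open>C\<^sub>m\<close> (\<open>dn\<close>);
  eliminating \<open>K\<close> gives the induction step.\<close>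

lemma gram_diag:
  assumes "s \<ge> 0"
  shows "(real n + s + 1/2) * gram s n n = (s + 1/2) * gram s 0 0 * gegenbauer (s + 1/2) n 1"
proof (induction n)
  case 0
  then show ?case by simp
next
  case (Suc n)
  define \<beta> where "\<beta> = s + 1/2"
  let ?C = "gegenbauer \<beta>" and ?W = "weight (-1) 1 s"
  define K where "K = (\<integral>x. x * ?C (Suc n) x * ?C n x * ?W x \<partial>IM)"
  note ci = integrable_weight_mult[OF assms] continuous_intros continuous_on_gegenbauer
  have intK: "integrable IM (\<lambda>x. x * ?C (Suc n) x * ?C n x * ?W x)"
    by (intro ci)
  have int: "integrable IM (\<lambda>x. ?C i x * ?C j x * ?W x)" for i j
    by (intro ci)
  have up: "2 * (real n + 1 + \<beta>) * K = (real n + 2 * \<beta>) * gram s n n"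
  proof -
    have "(real n + 2) * gram s (Suc (Suc n)) n =
       (\<integral>x. ((real n + 2) * ?C (Suc (Suc n)) x) * ?C n x * ?W x \<partial>IM)"
      by (simp add: gram_def \<beta>_def mult.assoc)
    also have "\<dots> = (\<integral>x. 2 * (real n + 1 + \<beta>) * (x * ?C (Suc n) x * ?C n x * ?W x)
        - (real n + 2 * \<beta>) * (?C n x * ?C n x * ?W x) \<partial>IM)"
      unfolding gegenbauer_rec by (simp add: algebra_simps)
    also have "\<dots> = 2 * (real n + 1 + \<beta>) * K - (real n + 2 * \<beta>) * gram s n n"
      using intK int by (simp add: K_def gram_def \<beta>_def del: distrib_left_numeral)
    finally show ?thesis using gram_orthogonal[OF assms, of "Suc (Suc n)" n] by simp
  qed
  have dn: "(real n + 1) * gram s (Suc n) (Suc n) = 2 * (real n + \<beta>) * K"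
  proof (cases n)
    case 0
    have "2 * \<beta> * K = (\<integral>x. 2 * \<beta> * (x * ?C (Suc n) x * ?C n x * ?W x) \<partial>IM)"
      by (simp add: K_def)
    also have "\<dots> = gram s (Suc n) (Suc n)" by (simp add: 0 gram_def \<beta>_def mult_ac)
    finally show ?thesis by (simp add: 0)
  next
    case (Suc l)
    have "(real l + 2) * gram s (Suc (Suc l)) (Suc n) =
       (\<integral>x. ((real l + 2) * ?C (Suc (Suc l)) x) * ?C (Suc n) x * ?W x \<partial>IM)"
      by (simp add: gram_def \<beta>_def mult.assoc)
    also have "\<dots> = (\<integral>x. 2 * (real l + 1 + \<beta>) * (x * ?C (Suc n) x * ?C n x * ?W x)
        - (real l + 2 * \<beta>) * (?C l x * ?C (Suc n) x * ?W x) \<partial>IM)"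
      unfolding gegenbauer_rec by (simp add: Suc algebra_simps)
    also have "\<dots> = 2 * (real l + 1 + \<beta>) * K - (real l + 2 * \<beta>) * gram s l (Suc n)"
      using intK int by (simp add: K_def gram_def \<beta>_def del: distrib_left_numeral)
    finally show ?thesis using gram_orthogonal[OF assms, of l "Suc n"] by (simp add: Suc algebra_simps)
  qed
  have IH: "(real n + \<beta>) * gram s n n = \<beta> * gram s 0 0 * ?C n 1"
    using Suc by (simp add: \<beta>_def add.assoc)
  have "(real n + 1) * ((real n + 1 + \<beta>) * gram s (Suc n) (Suc n))
      = (real n + 1) * (\<beta> * gram s 0 0 * ?C (Suc n) 1)"
    using up dn IH gegenbauer_at_1_Suc[of n \<beta>] by algebra
  moreover have "real n + 1 \<noteq> 0" by (simp add: add_nonneg_eq_0_iff)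
  ultimately have "(real n + 1 + \<beta>) * gram s (Suc n) (Suc n) = \<beta> * gram s 0 0 * ?C (Suc n) 1"
    by (metis mult_cancel_left)
  then show ?case by (simp add: \<beta>_def algebra_simps)
qed

lemma gram_pos:
  assumes "s \<ge> 0"
  shows "gram s n n > 0"
proof -
  have "(real n + s + 1/2) * gram s n n > 0"
    unfolding gram_diag[OF assms] using assms gram_0_pos[OF assms] gegenbauer_at_1_pos[of "s + 1/2" n]
    by (intro mult_pos_pos) auto
  then show ?thesis using assms by (simp add: zero_less_mult_iff)
qed

text \<open>Since the recurrence expresses \<open>x C\<^sub>n\<close> by the two neighbours of \<open>C\<^sub>n\<close>, induction on \<open>m\<close>
  shows that \<open>g\<close> is orthogonal to \<open>x\<^sup>m C\<^sub>n\<close> for all \<open>n\<close>; take \<open>n = 0\<close> at the end.\<close>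

lemma integral_gegenbauer_eq_0_imp_monomial:
  assumes g: "integrable IM g" and \<beta>: "\<beta> > 0"
    and orth: "\<And>n. (\<integral>x. g x * gegenbauer \<beta> n x \<partial>IM) = 0"
  shows "(\<integral>x. g x * x ^ m \<partial>IM) = 0"
proof -
  have "(\<integral>x. g x * (x ^ m * gegenbauer \<beta> n x) \<partial>IM) = 0" for n
  proof (induction m arbitrary: n)
    case 0
    then show ?case by (simp add: orth)
  next
    case (Suc m)
    let ?C = "gegenbauer \<beta>"
    have int: "integrable IM (\<lambda>x. g x * (x ^ k * ?C j x))" for j k
      by (intro integrable_mult_continuous g continuous_intros continuous_on_gegenbauer)
    show ?case
    proof (cases n)
      case 0
      have "2 * \<beta> * (\<integral>x. g x * (x ^ Suc m * ?C n x) \<partial>IM) = (\<integral>x. g x * (x ^ m * ?C 1 x) \<partial>IM)"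
        unfolding integral_mult_right_zero[symmetric] by (simp add: 0 mult_ac)
      then show ?thesis using Suc.IH[of 1] \<beta> by simp
    next
      case n: (Suc l)
      have "2 * (real l + 1 + \<beta>) * (\<integral>x. g x * (x ^ Suc m * ?C n x) \<partial>IM)
        = (\<integral>x. g x * (x ^ m * (2 * (real l + 1 + \<beta>) * x * ?C (Suc l) x)) \<partial>IM)"
        unfolding integral_mult_right_zero[symmetric] by (simp add: n mult_ac)
      also have "\<dots> = (\<integral>x. (real l + 2) * (g x * (x ^ m * ?C (Suc (Suc l)) x))
          + (real l + 2 * \<beta>) * (g x * (x ^ m * ?C l x)) \<partial>IM)"
      proof (rule Bochner_Integration.integral_cong[OF refl])
        fix x
        show "g x * (x ^ m * (2 * (real l + 1 + \<beta>) * x * ?C (Suc l) x)) =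
          (real l + 2) * (g x * (x ^ m * ?C (Suc (Suc l)) x)) + (real l + 2 * \<beta>) * (g x * (x ^ m * ?C l x))"
          using arg_cong[OF gegenbauer_rec[of l \<beta> x], of "\<lambda>y. g x * x ^ m * y"]
          by (simp add: algebra_simps)
      qed
      also have "\<dots> = 0" using int by (simp add: Suc.IH)
      finally show ?thesis using \<beta> by (simp add: add_nonneg_eq_0_iff)
    qed
  qed
  from this[of 0] show ?thesis by simp
qed

lemma integral_continuous_eq_0_of_monomial:
  assumes g: "integrable IM g" and mon: "\<And>m. (\<integral>x. g x * x ^ m \<partial>IM) = 0"
    and p: "continuous_on {-1..1} p"
  shows "(\<integral>x. g x * p x \<partial>IM) = 0"
proof -
  define G where "G = (\<integral>x. \<bar>g x\<bar> \<partial>IM)"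
  have G: "G \<ge> 0" by (simp add: G_def)
  have "\<bar>\<integral>x. g x * p x \<partial>IM\<bar> \<le> 0 + e" if "e > 0" for e
  proof -
    define d where "d = e / (G + 1)"
    have "d > 0" using that G by (simp add: d_def)
    then obtain q where q: "real_polynomial_function q" "\<And>x. x \<in> {-1..1} \<Longrightarrow> \<bar>p x - q x\<bar> < d"
      using Stone_Weierstrass_real_polynomial_function[OF compact_Icc p] by blast
    from q(1) obtain a n where qe: "q = (\<lambda>x. \<Sum>i\<le>n. a i * x ^ i)"
      unfolding real_polynomial_function_iff_sum by blast
    have int: "integrable IM (\<lambda>x. g x * x ^ i)" for i
      by (intro integrable_mult_continuous g continuous_intros)
    have "(\<integral>x. g x * q x \<partial>IM) = (\<integral>x. (\<Sum>i\<le>n. a i * (g x * x ^ i)) \<partial>IM)"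
      by (simp add: qe sum_distrib_left mult_ac)
    also have "\<dots> = 0" using int by (simp add: mon)
    finally have q0: "(\<integral>x. g x * q x \<partial>IM) = 0" .
    have ip: "integrable IM (\<lambda>x. g x * p x)" by (intro integrable_mult_continuous g p)
    have iq: "integrable IM (\<lambda>x. g x * q x)"
      unfolding qe by (intro integrable_mult_continuous g continuous_intros)
    have "\<bar>\<integral>x. g x * p x \<partial>IM\<bar> = \<bar>\<integral>x. g x * p x - g x * q x \<partial>IM\<bar>"
      using ip iq q0 by simp
    also have "\<dots> \<le> (\<integral>x. \<bar>g x * p x - g x * q x\<bar> \<partial>IM)"
      by (rule integral_abs_bound)
    also have "\<dots> \<le> (\<integral>x. d * \<bar>g x\<bar> \<partial>IM)"
    proof (rule integral_mono)
      fix x assume "x \<in> space IM"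
      then have "\<bar>p x - q x\<bar> \<le> d" using q(2)[of x] by (auto simp: space_restrict_space)
      then have "\<bar>g x\<bar> * \<bar>p x - q x\<bar> \<le> \<bar>g x\<bar> * d" by (intro mult_left_mono) auto
      then show "\<bar>g x * p x - g x * q x\<bar> \<le> d * \<bar>g x\<bar>"
        by (simp add: abs_mult[symmetric] algebra_simps)
    qed (use ip iq g in auto)
    also have "\<dots> = d * G" by (simp add: G_def)
    also have "\<dots> \<le> e" using that G by (simp add: d_def field_simps)
    finally show ?thesis by simp
  qed
  then have "\<bar>\<integral>x. g x * p x \<partial>IM\<bar> \<le> 0" by (rule field_le_epsilon)
  then show ?thesis by simp
qed

text \<open>The sign of \<open>g\<close> is an almost everywhere limit of continuous functions, which may be truncated to
  \<open>[-1,1]\<close>; dominated convergence then shows that the integral of \<open>\<bar>g\<bar>\<close> is zero.\<close>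

lemma AE_eq_0_of_integral_continuous:
  assumes g: "integrable IM g"
    and orth: "\<And>p. continuous_on UNIV p \<Longrightarrow> (\<integral>x. g x * p x \<partial>IM) = 0"
  shows "AE x in IM. g x = (0::real)"
proof -
  have gm: "g \<in> borel_measurable IM" using g by simp
  then have "(\<lambda>x. sgn (g x)) \<in> borel_measurable IM" by simp
  then have "(\<lambda>x. sgn (g x)) measurable_on {-1<..<1}"
    by (intro measurable_on_iff_borel_measurable[THEN iffD2]) auto
  then obtain N \<phi> where N: "negligible N" and \<phi>: "\<And>n. continuous_on UNIV (\<phi> n)"
    and lim: "\<And>x. x \<notin> N \<Longrightarrow> (\<lambda>n. \<phi> n x) \<longlonglongrightarrow> (if x \<in> {-1<..<1} then sgn (g x) else 0)"
    unfolding measurable_on_def by blast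
  define \<psi> where "\<psi> = (\<lambda>n x. max (-1) (min 1 (\<phi> n x)))"
  have \<psi>: "continuous_on A (\<psi> n)" for n A
    unfolding \<psi>_def using \<phi>[of n] by (intro continuous_intros continuous_on_subset[OF \<phi>[of n]]) auto
  have "(\<lambda>n. \<integral>x. g x * \<psi> n x \<partial>IM) \<longlonglongrightarrow> (\<integral>x. \<bar>g x\<bar> \<partial>IM)"
  proof (rule integral_dominated_convergence)
    show "integrable IM (\<lambda>x. \<bar>g x\<bar>)" using g by simp
    show "(\<lambda>x. g x * \<psi> n x) \<in> borel_measurable IM" for n
      using gm continuous_measurable_IM[OF \<psi>[of _ n]] by simp
    show "AE x in IM. norm (g x * \<psi> n x) \<le> \<bar>g x\<bar>" for n
    proof (rule AE_I2)
      fix x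
      have "\<bar>\<psi> n x\<bar> \<le> 1" by (auto simp: \<psi>_def)
      then show "norm (g x * \<psi> n x) \<le> \<bar>g x\<bar>" by (simp add: abs_mult mult_left_le)
    qed
    have "AE x in lebesgue. x \<notin> N"
      using N by (simp add: negligible_iff_null_sets AE_not_in)
    then have "AE x in IM. x \<notin> N"
      by (subst AE_restrict_space_iff) auto
    then show "AE x in IM. (\<lambda>n. g x * \<psi> n x) \<longlonglongrightarrow> \<bar>g x\<bar>"
      using AE_space
    proof eventually_elim
      case (elim x)
      then have "(\<lambda>n. \<phi> n x) \<longlonglongrightarrow> sgn (g x)" using lim[of x] by (simp add: space_restrict_space)
      then have "(\<lambda>n. g x * \<psi> n x) \<longlonglongrightarrow> g x * max (-1) (min 1 (sgn (g x)))"
        unfolding \<psi>_def by (intro tendsto_intros)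
      also have "max (-1) (min 1 (sgn (g x))) = sgn (g x)" by (auto simp: sgn_if)
      also have "g x * sgn (g x) = \<bar>g x\<bar>" by (simp add: sgn_if)
      finally show ?case .
    qed
  qed (use gm in simp)
  then have "(\<integral>x. \<bar>g x\<bar> \<partial>IM) = 0"
    using orth[OF \<psi>] by (simp add: LIMSEQ_const_iff)
  then have "AE x in IM. \<bar>g x\<bar> = 0"
    using g by (subst (asm) integral_nonneg_eq_0_iff_AE) auto
  then show ?thesis by simp
qed

lemma gegenbauer_complete:
  assumes "integrable IM g" "\<beta> > 0"
    and "\<And>n. (\<integral>x. g x * gegenbauer \<beta> n x \<partial>IM) = 0"
  shows "AE x in IM. g x = 0"
  using integral_continuous_eq_0_of_monomial[OF assms(1) integral_gegenbauer_eq_0_imp_monomial[OF assms]]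
  by (intro AE_eq_0_of_integral_continuous[OF assms(1)]) (auto intro: continuous_on_subset)

section \<open>Gegenbauer series of Sobolev functions\<close>

lemma L2s_norm_gegenbauer: "L2s_norm (-1) 1 s (gegenbauer (s + 1/2) j) = sqrt (gram s j j)"
  by (simp add: L2s_norm_def gram_def power2_eq_square)

text \<open>The \<open>i\<close>-th derivative of the \<open>j\<close>-th normalized Gegenbauer polynomial.\<close>

definition gegenbauer_normalized_D :: "nat \<Rightarrow> real \<Rightarrow> nat \<Rightarrow> real \<Rightarrow> real" where
  "gegenbauer_normalized_D i s j x = gegenbauer_D i (s + 1/2) j x / sqrt (gram s j j)"

lemma gegenbauer_normalized_D_0: "gegenbauer_normalized_D 0 s j x = gegenbauer_normalized s j x"
  by (simp add: gegenbauer_normalized_D_def gegenbauer_normalized_def L2s_norm_gegenbauer)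

lemma gegenbauer_normalized_D_has_derivative:
  "(gegenbauer_normalized_D i s j has_real_derivative gegenbauer_normalized_D (Suc i) s j x) (at x within A)"
  unfolding gegenbauer_normalized_D_def[abs_def] by (rule DERIV_cdivide[OF gegenbauer_D_has_derivative])

lemma continuous_on_gegenbauer_normalized_D: "continuous_on A (gegenbauer_normalized_D i s j)"
  using gegenbauer_normalized_D_has_derivative by (rule DERIV_continuous_on)

lemma real_le_powr_half: "real j \<le> (1 + (real j)\<^sup>2) powr (1/2)"
  by (simp add: powr_half_sqrt real_le_rsqrt)

lemma gegenbauer_at_1_le_powr:
  assumes "\<beta> \<ge> 1/2"
  shows "gegenbauer \<beta> j 1 \<le> 2 * \<beta> * (1 + (real j)\<^sup>2) powr (\<beta> - 1/2)"
proof (cases j)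
  case 0
  then show ?thesis using assms by simp
next
  case (Suc n)
  have "gegenbauer \<beta> j 1 \<le> 2 * \<beta> * real j powr (2 * \<beta> - 1)"
    using gegenbauer_at_1_le[OF assms, of n] by (simp add: Suc add.commute)
  also have "real j powr (2 * \<beta> - 1) \<le> ((1 + (real j)\<^sup>2) powr (1/2)) powr (2 * \<beta> - 1)"
    using assms real_le_powr_half[of j] by (intro powr_mono2) auto
  also have "\<dots> = (1 + (real j)\<^sup>2) powr (\<beta> - 1/2)"
    by (simp add: powr_powr field_simps)
  finally show ?thesis using assms by simp
qed

text \<open>The exponent of \<open>1 + j\<^sup>2\<close> is \<open>i\<close> from the \<open>i\<close> derivatives plus \<open>\<beta>/2 = s/2 + 1/4\<close> from the
  quotient \<open>C\<^sub>j(1) / sqrt h\<^sub>j\<close>.\<close>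

lemma gegenbauer_normalized_D_bound:
  assumes "s \<ge> 0"
  shows "\<exists>K\<ge>0. \<forall>j x. \<bar>x\<bar> \<le> 1 \<longrightarrow>
    \<bar>gegenbauer_normalized_D i s j x\<bar> \<le> K * (1 + (real j)\<^sup>2) powr (real i + s/2 + 1/4)"
proof -
  define \<beta> where "\<beta> = s + 1/2"
  define h where "h = gram s 0 0"
  have \<beta>: "\<beta> \<ge> 1/2" and h: "h > 0" using assms gram_0_pos[OF assms] by (auto simp: \<beta>_def h_def)
  define A where "A = 1 + 2 * \<beta> + real i"
  define B where "B = sqrt (2 * (1 + \<beta>) / h)"
  have "\<bar>gegenbauer_normalized_D i s j x\<bar> \<le> A ^ (2 * i) * B * (1 + (real j)\<^sup>2) powr (real i + s/2 + 1/4)"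
    if x: "\<bar>x\<bar> \<le> 1" for j x
  proof -
    define q where "q = 1 + (real j)\<^sup>2"
    have q: "q \<ge> 1" by (simp add: q_def)
    have j: "real j \<le> q powr (1/2)" unfolding q_def by (rule real_le_powr_half)
    have q1: "1 \<le> q powr (1/2)" using q by (simp add: ge_one_powr_ge_zero)
    let ?c = "gegenbauer \<beta> j 1" and ?g = "gram s j j"
    have g: "?g > 0" and c: "?c > 0" using gram_pos[OF assms] gegenbauer_at_1_pos \<beta> by auto
    have geq: "(real j + \<beta>) * ?g = \<beta> * h * ?c"
      using gram_diag[OF assms, of j] by (simp add: \<beta>_def h_def add.assoc)
    have jb: "real j + \<beta> \<le> (1 + \<beta>) * q powr (1/2)"
      using add_mono[OF j mult_left_mono[OF q1, of \<beta>]] \<beta> by (simp add: algebra_simps)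
    have "?c / ?g = (real j + \<beta>) / (\<beta> * h)"
    proof (rule frac_eq_eq[THEN iffD2])
      show "?c * (\<beta> * h) = (real j + \<beta>) * ?g" unfolding geq by simp
    qed (use g h \<beta> in auto)
    then have "?c * (?c / ?g) = ?c * ((real j + \<beta>) / (\<beta> * h))" by (rule arg_cong)
    then have "?c\<^sup>2 / ?g = ?c * (real j + \<beta>) / (\<beta> * h)"
      by (simp only: power2_eq_square times_divide_eq_right)
    also have "\<dots> \<le> (2 * \<beta> * q powr (\<beta> - 1/2)) * ((1 + \<beta>) * q powr (1/2)) / (\<beta> * h)"
      using jb gegenbauer_at_1_le_powr[OF \<beta>, of j] \<beta> h c
      by (intro divide_right_mono mult_mono) (auto simp: q_def)
    also have "\<dots> = 2 * (1 + \<beta>) / h * (q powr (\<beta> - 1/2) * q powr (1/2))" using \<beta> h by (simp add: field_simps)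
    also have "\<dots> = 2 * (1 + \<beta>) / h * q powr \<beta>" by (simp add: powr_add[symmetric])
    finally have "sqrt (?c\<^sup>2 / ?g) \<le> sqrt (2 * (1 + \<beta>) / h * q powr \<beta>)" by simp
    moreover have "sqrt (?c\<^sup>2 / ?g) = ?c / sqrt ?g" using c by (simp add: real_sqrt_divide)
    moreover have "sqrt (2 * (1 + \<beta>) / h * q powr \<beta>) = B * sqrt (q powr \<beta>)"
      unfolding B_def by (rule real_sqrt_mult)
    moreover have "sqrt (q powr \<beta>) = q powr (\<beta> / 2)"
      by (simp add: powr_half_sqrt[symmetric] powr_powr)
    ultimately have cg: "?c / sqrt ?g \<le> B * q powr (\<beta> / 2)" by simp
    have "real j + 2 * \<beta> + real i \<le> A * q powr (1/2)"
      using add_mono[OF j mult_left_mono[OF q1, of "2 * \<beta> + real i"]] \<beta>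
      by (simp add: A_def algebra_simps)
    then have "(real j + 2 * \<beta> + real i) ^ (2 * i) \<le> (A * q powr (1/2)) ^ (2 * i)"
      using \<beta> by (intro power_mono) auto
    also have "\<dots> = A ^ (2 * i) * q powr real i"
      using q by (simp add: power_mult_distrib powr_power)
    finally have pw: "(real j + 2 * \<beta> + real i) ^ (2 * i) \<le> A ^ (2 * i) * q powr real i" .
    have "\<bar>gegenbauer_normalized_D i s j x\<bar> = \<bar>gegenbauer_D i \<beta> j x\<bar> / sqrt ?g"
      using g by (simp add: gegenbauer_normalized_D_def \<beta>_def)
    also have "\<dots> \<le> (real j + 2 * \<beta> + real i) ^ (2 * i) * ?c / sqrt ?g"
      using g \<beta> x by (intro divide_right_mono gegenbauer_D_le) auto
    also have "\<dots> = (real j + 2 * \<beta> + real i) ^ (2 * i) * (?c / sqrt ?g)" by simp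
    also have "\<dots> \<le> (A ^ (2 * i) * q powr real i) * (B * q powr (\<beta> / 2))"
      using g c \<beta> by (intro mult_mono pw cg) (auto simp: A_def)
    also have "\<dots> = A ^ (2 * i) * B * (q powr real i * q powr (\<beta> / 2))" by simp
    also have "q powr real i * q powr (\<beta> / 2) = q powr (real i + s/2 + 1/4)"
      by (simp add: powr_add[symmetric] \<beta>_def add_divide_distrib add.assoc)
    finally show ?thesis by (simp add: q_def)
  qed
  moreover have "A ^ (2 * i) * B \<ge> 0" using \<beta> h by (simp add: A_def B_def)
  ultimately show ?thesis by blast
qed

lemma Cauchy_Schwarz_suminf:
  fixes a b :: "nat \<Rightarrow> real"
  assumes a: "summable (\<lambda>j. (a j)\<^sup>2)" and b: "summable (\<lambda>j. (b j)\<^sup>2)"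
  shows "summable (\<lambda>j. \<bar>a j * b j\<bar>)"
    and "(\<Sum>j. \<bar>a j * b j\<bar>) \<le> sqrt (\<Sum>j. (a j)\<^sup>2) * sqrt (\<Sum>j. (b j)\<^sup>2)"
proof -
  show sm: "summable (\<lambda>j. \<bar>a j * b j\<bar>)"
  proof (rule summable_comparison_test')
    show "summable (\<lambda>j. (a j)\<^sup>2 + (b j)\<^sup>2)" using a b by (rule summable_add)
    show "norm \<bar>a j * b j\<bar> \<le> (a j)\<^sup>2 + (b j)\<^sup>2" for j
      using sum_squares_bound[of "\<bar>a j\<bar>" "\<bar>b j\<bar>"] mult_nonneg_nonneg[of "\<bar>a j\<bar>" "\<bar>b j\<bar>"]
      unfolding real_norm_def abs_abs abs_mult power2_abs by linarith
  qed
  show "(\<Sum>j. \<bar>a j * b j\<bar>) \<le> sqrt (\<Sum>j. (a j)\<^sup>2) * sqrt (\<Sum>j. (b j)\<^sup>2)"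
  proof (rule suminf_le_const[OF sm])
    fix n
    have "(\<Sum>j<n. \<bar>a j * b j\<bar>)\<^sup>2 \<le> (\<Sum>j<n. \<bar>a j\<bar>\<^sup>2) * (\<Sum>j<n. \<bar>b j\<bar>\<^sup>2)"
      unfolding abs_mult by (rule Cauchy_Schwarz_ineq_sum)
    also have "\<dots> \<le> (\<Sum>j. (a j)\<^sup>2) * (\<Sum>j. (b j)\<^sup>2)"
      using a b by (intro mult_mono) (auto intro!: sum_le_suminf suminf_nonneg sum_nonneg)
    finally have "(\<Sum>j<n. \<bar>a j * b j\<bar>) \<le> sqrt ((\<Sum>j. (a j)\<^sup>2) * (\<Sum>j. (b j)\<^sup>2))"
      by (rule real_le_rsqrt)
    then show "(\<Sum>j<n. \<bar>a j * b j\<bar>) \<le> sqrt (\<Sum>j. (a j)\<^sup>2) * sqrt (\<Sum>j. (b j)\<^sup>2)"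
      by (simp add: real_sqrt_mult)
  qed
qed

text \<open>Split the weight of \<open>\<bar>v\<^sub>j\<bar>\<close> into the Sobolev weight with exponent \<open>r/2\<close> and the remaining
  factor with exponent \<open>(t - r)/2\<close>, which is square summable because \<open>2 (t - r) < -1\<close>.\<close>

lemma Hrs_ref_coeff_summable:
  assumes "t < r - 1/2"
  shows "\<exists>S. \<forall>v\<in>Hrs_ref r s.
    summable (\<lambda>j. \<bar>gegenbauer_coeff s v j\<bar> * (1 + (real j)\<^sup>2) powr (t / 2)) \<and>
    (\<Sum>j. \<bar>gegenbauer_coeff s v j\<bar> * (1 + (real j)\<^sup>2) powr (t / 2)) \<le> S * Hrs_ref_norm r s v"
proof -
  define q where "q = (\<lambda>j::nat. 1 + (real j)\<^sup>2)"
  have q: "q j > 0" for j by (simp add: q_def add_pos_nonneg)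
  define b where "b = (\<lambda>j. q j powr ((t - r) / 2))"
  have sqb: "(b j)\<^sup>2 = q j powr (t - r)" for j
    by (simp add: b_def power2_eq_square powr_add[symmetric])
  have sb: "summable (\<lambda>j. (b j)\<^sup>2)"
  proof (rule summable_comparison_test'[where N = 1])
    show "summable (\<lambda>j. real j powr (2 * (t - r)))"
      using assms by (simp add: summable_real_powr_iff)
    fix j :: nat assume "j \<ge> 1"
    then have "q j powr (t - r) \<le> ((real j)\<^sup>2) powr (t - r)"
      using assms by (intro powr_mono2') (auto simp: q_def)
    also have "\<dots> = real j powr (2 * (t - r))"
      using \<open>j \<ge> 1\<close> by (simp add: powr_powr powr_numeral[symmetric] del: powr_numeral)
    finally show "norm ((b j)\<^sup>2) \<le> real j powr (2 * (t - r))" by (simp add: sqb)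
  qed
  show ?thesis
  proof (intro exI ballI)
    fix v assume v: "v \<in> Hrs_ref r s"
    define a where "a = (\<lambda>j. q j powr (r / 2) * \<bar>gegenbauer_coeff s v j\<bar>)"
    have sqa: "(a j)\<^sup>2 = q j powr r * \<bar>gegenbauer_coeff s v j\<bar>\<^sup>2" for j
      by (simp add: a_def power_mult_distrib power2_eq_square[of "_ powr _"] powr_add[symmetric])
    have sa: "summable (\<lambda>j. (a j)\<^sup>2)"
      using v unfolding sqa by (simp add: Hrs_ref_def q_def)
    have ab: "\<bar>a j * b j\<bar> = \<bar>gegenbauer_coeff s v j\<bar> * (1 + (real j)\<^sup>2) powr (t / 2)" for j
    proof -
      have "\<bar>a j * b j\<bar> = \<bar>gegenbauer_coeff s v j\<bar> * (q j powr (r / 2) * q j powr ((t - r) / 2))"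
        by (simp add: a_def b_def abs_mult)
      also have "q j powr (r / 2) * q j powr ((t - r) / 2) = q j powr (t / 2)"
        by (simp add: powr_add[symmetric] diff_divide_distrib)
      finally show ?thesis by (simp add: q_def)
    qed
    have "sqrt (\<Sum>j. (a j)\<^sup>2) = Hrs_ref_norm r s v"
      unfolding sqa by (simp add: Hrs_ref_norm_def q_def)
    then show "summable (\<lambda>j. \<bar>gegenbauer_coeff s v j\<bar> * (1 + (real j)\<^sup>2) powr (t / 2)) \<and>
      (\<Sum>j. \<bar>gegenbauer_coeff s v j\<bar> * (1 + (real j)\<^sup>2) powr (t / 2))
        \<le> sqrt (\<Sum>j. (b j)\<^sup>2) * Hrs_ref_norm r s v"
      using Cauchy_Schwarz_suminf[OF sa sb] unfolding ab by (simp add: mult.commute)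
  qed
qed

text \<open>The formal \<open>i\<close>-th derivative of the series with coefficients \<open>c\<close> in the normalized polynomials. It
  is meaningful only where the series converges.\<close>

definition gegenbauer_series :: "nat \<Rightarrow> real \<Rightarrow> (nat \<Rightarrow> real) \<Rightarrow> real \<Rightarrow> real" where
  "gegenbauer_series i s c x = (\<Sum>j. c j * gegenbauer_normalized_D i s j x)"

lemma gegenbauer_series_majorant:
  assumes "s \<ge> 0"
  shows "\<exists>K\<ge>0. \<forall>i\<le>k. \<forall>j x. \<bar>x\<bar> \<le> 1 \<longrightarrow>
    \<bar>gegenbauer_normalized_D i s j x\<bar> \<le> K * (1 + (real j)\<^sup>2) powr (real k + s/2 + 1/4)"
proof -
  obtain K where K: "\<And>i. K i \<ge> 0" and le: "\<And>i j x. \<bar>x\<bar> \<le> 1 \<Longrightarrow>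
    \<bar>gegenbauer_normalized_D i s j x\<bar> \<le> K i * (1 + (real j)\<^sup>2) powr (real i + s/2 + 1/4)"
    using gegenbauer_normalized_D_bound[OF assms] by metis
  have "\<bar>gegenbauer_normalized_D i s j x\<bar> \<le> (\<Sum>i\<le>k. K i) * (1 + (real j)\<^sup>2) powr (real k + s/2 + 1/4)"
    if "i \<le> k" "\<bar>x\<bar> \<le> 1" for i j x
  proof -
    have "K i \<le> (\<Sum>i\<le>k. K i)" using that K by (intro member_le_sum) auto
    moreover have "(1 + (real j)\<^sup>2) powr (real i + s/2 + 1/4) \<le> (1 + (real j)\<^sup>2) powr (real k + s/2 + 1/4)"
      using that by (intro powr_mono) auto
    ultimately have "K i * (1 + (real j)\<^sup>2) powr (real i + s/2 + 1/4)
        \<le> (\<Sum>i\<le>k. K i) * (1 + (real j)\<^sup>2) powr (real k + s/2 + 1/4)"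
      using K by (intro mult_mono sum_nonneg) auto
    with le[OF that(2), of i j] show ?thesis by linarith
  qed
  then show ?thesis using K by (intro exI[of _ "\<Sum>i\<le>k. K i"]) (auto intro: sum_nonneg)
qed

text \<open>Under a summable majorant for all derivatives up to order \<open>k\<close>, the series converges uniformly
  and may be differentiated term by term on the closed interval, one-sidedly at the end points.\<close>

lemma gegenbauer_series_properties:
  assumes M: "summable M"
    and le: "\<And>i j x. i \<le> k \<Longrightarrow> \<bar>x\<bar> \<le> 1 \<Longrightarrow> \<bar>c j * gegenbauer_normalized_D i s j x\<bar> \<le> M j"
  shows "i \<le> k \<Longrightarrow> \<bar>x\<bar> \<le> 1 \<Longrightarrow> summable (\<lambda>j. c j * gegenbauer_normalized_D i s j x)"
    and "i \<le> k \<Longrightarrow> \<bar>x\<bar> \<le> 1 \<Longrightarrow> \<bar>gegenbauer_series i s c x\<bar> \<le> suminf M"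
    and "i \<le> k \<Longrightarrow> continuous_on {-1..1} (gegenbauer_series i s c)"
    and "i < k \<Longrightarrow> \<bar>x\<bar> \<le> 1 \<Longrightarrow> (gegenbauer_series i s c has_real_derivative
            gegenbauer_series (Suc i) s c x) (at x within {-1..1})"
proof -
  have sm: "summable (\<lambda>j. \<bar>c j * gegenbauer_normalized_D i s j x\<bar>)" if "i \<le> k" "\<bar>x\<bar> \<le> 1" for i x
    by (rule summable_comparison_test'[OF M]) (use le that in auto)
  show s1: "summable (\<lambda>j. c j * gegenbauer_normalized_D i s j x)" if "i \<le> k" "\<bar>x\<bar> \<le> 1" for i x
    by (rule summable_rabs_cancel[OF sm[OF that]])
  show "\<bar>gegenbauer_series i s c x\<bar> \<le> suminf M" if "i \<le> k" "\<bar>x\<bar> \<le> 1"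
    unfolding gegenbauer_series_def
    using summable_rabs[OF sm[OF that]] suminf_le[OF _ sm[OF that] M] le that by force
  have lim: "uniform_limit {-1..1} (\<lambda>n x. \<Sum>j<n. c j * gegenbauer_normalized_D i s j x)
      (gegenbauer_series i s c) sequentially" if "i \<le> k" for i
    unfolding gegenbauer_series_def
    by (rule Weierstrass_m_test[OF _ M]) (use le that in \<open>auto simp: abs_le_iff\<close>)
  show "continuous_on {-1..1} (gegenbauer_series i s c)" if "i \<le> k"
    by (rule uniform_limit_theorem[OF _ lim[OF that]])
       (auto intro!: always_eventually continuous_intros continuous_on_gegenbauer_normalized_D)
  show "(gegenbauer_series i s c has_real_derivative
            gegenbauer_series (Suc i) s c x) (at x within {-1..1})" if i: "i < k" and x: "\<bar>x\<bar> \<le> 1"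
  proof -
    have "\<exists>g. \<forall>x\<in>{-1..1}. (\<lambda>j. c j * gegenbauer_normalized_D i s j x) sums g x \<and>
        (g has_real_derivative gegenbauer_series (Suc i) s c x) (at x within {-1..1})"
    proof (rule has_field_derivative_series)
      show "uniform_limit {-1..1} (\<lambda>n x. \<Sum>j<n. c j * gegenbauer_normalized_D (Suc i) s j x)
        (gegenbauer_series (Suc i) s c) sequentially" using i by (intro lim) auto
      show "((\<lambda>x. c n * gegenbauer_normalized_D i s n x) has_real_derivative c n * gegenbauer_normalized_D (Suc i) s n x)
        (at x within {-1..1})" for n x
        by (rule DERIV_cmult[OF gegenbauer_normalized_D_has_derivative])
      show "summable (\<lambda>j. c j * gegenbauer_normalized_D i s j 0)" using i by (intro s1) auto
    qed auto
    then obtain g where g: "\<And>x. x \<in> {-1..1} \<Longrightarrow> (\<lambda>j. c j * gegenbauer_normalized_D i s j x) sums g x"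
      and dg: "\<And>x. x \<in> {-1..1} \<Longrightarrow>
        (g has_real_derivative gegenbauer_series (Suc i) s c x) (at x within {-1..1})" by blast
    have "gegenbauer_series i s c y = g y" if "y \<in> {-1..1}" for y
      using g[OF that] by (simp add: gegenbauer_series_def sums_iff)
    moreover have x': "x \<in> {-1..1}" using x by auto
    ultimately show ?thesis
      using dg[of x] x' unfolding has_real_derivative_iff_has_vector_derivative
      by (blast intro: has_vector_derivative_transform)
  qed
qed

lemma gegenbauer_series_coeff:
  assumes "s \<ge> 0" and M: "summable M"
    and le: "\<And>j x. \<bar>x\<bar> \<le> 1 \<Longrightarrow> \<bar>c j * gegenbauer_normalized_D 0 s j x\<bar> \<le> M j"
  shows "(\<integral>x. gegenbauer_series 0 s c x * gegenbauer (s + 1/2) n x * weight (-1) 1 s x \<partial>IM)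
    = c n * sqrt (gram s n n)"
proof -
  let ?C = "gegenbauer (s + 1/2)" and ?W = "weight (-1) 1 s"
  define f where "f = (\<lambda>j x. c j * gegenbauer_normalized_D 0 s j x * ?C n x * ?W x)"
  have \<beta>: "s + 1/2 > 0" using assms by simp
  have int: "integrable IM (f j)" for j
    unfolding f_def
    by (intro integrable_weight_mult assms continuous_intros continuous_on_gegenbauer continuous_on_gegenbauer_normalized_D)
  have M0: "M j \<ge> 0" for j using le[of 0 j] by linarith
  have fle: "\<bar>f j x\<bar> \<le> M j * (?C n 1 * ?W x)" if "x \<in> space IM" for j x
  proof -
    have x: "\<bar>x\<bar> \<le> 1" "?W x > 0" using that weight_pos by (auto simp: space_restrict_space abs_le_iff)
    have "\<bar>f j x\<bar> = \<bar>c j * gegenbauer_normalized_D 0 s j x\<bar> * (\<bar>?C n x\<bar> * ?W x)"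
      using x by (simp add: f_def abs_mult)
    also have "\<dots> \<le> M j * (?C n 1 * ?W x)"
      using x le M0 gegenbauer_le_at_1[OF \<beta>, of x n] by (intro mult_mono mult_right_mono) auto
    finally show ?thesis .
  qed
  have "(\<lambda>j. integral\<^sup>L IM (f j)) sums (\<integral>x. (\<Sum>j. f j x) \<partial>IM)"
  proof (rule sums_integral)
    show "AE x in IM. summable (\<lambda>j. norm (f j x))"
    proof (rule AE_I2)
      fix x assume x: "x \<in> space IM"
      show "summable (\<lambda>j. norm (f j x))"
        by (rule summable_comparison_test'[OF summable_mult2[OF M, of "?C n 1 * ?W x"]]) (use fle x in auto)
    qed
    show "summable (\<lambda>j. \<integral>x. norm (f j x) \<partial>IM)"
    proof (rule summable_comparison_test'[OF summable_mult2[OF M, of "\<integral>x. ?C n 1 * ?W x \<partial>IM"]])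
      fix j
      have "(\<integral>x. norm (f j x) \<partial>IM) \<le> (\<integral>x. M j * (?C n 1 * ?W x) \<partial>IM)"
        using int fle integrable_weight[OF assms(1)] by (intro integral_mono) auto
      then show "norm (\<integral>x. norm (f j x) \<partial>IM) \<le> M j * (\<integral>x. ?C n 1 * ?W x \<partial>IM)"
        by simp
    qed
  qed (rule int)
  moreover have "integral\<^sup>L IM (f j) = (if j = n then c n * sqrt (gram s n n) else 0)" for j
  proof -
    have "integral\<^sup>L IM (f j) = (\<integral>x. c j / sqrt (gram s j j) * (?C j x * ?C n x * ?W x) \<partial>IM)"
      by (simp add: f_def gegenbauer_normalized_D_def mult.assoc del: Bochner_Integration.integral_mult_right_zero)
    also have "\<dots> = c j / sqrt (gram s j j) * gram s j n" by (simp add: gram_def)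
    also have "c j / sqrt (gram s j j) * gram s j n = (if j = n then c n * sqrt (gram s n n) else 0)"
    proof (cases "j = n")
      case True
      have "c n / sqrt (gram s n n) * gram s n n = c n * (gram s n n / sqrt (gram s n n))" by simp
      also have "gram s n n / sqrt (gram s n n) = sqrt (gram s n n)"
        using gram_pos[OF assms(1), of n] by (intro real_div_sqrt) simp
      finally show ?thesis using True by simp
    next
      case False
      then show ?thesis using gram_orthogonal[OF assms(1), of j n] by simp
    qed
    finally show ?thesis .
  qed
  ultimately have "(\<lambda>j. if j = n then c n * sqrt (gram s n n) else 0) sums (\<integral>x. (\<Sum>j. f j x) \<partial>IM)"
    by simp
  then have "(\<integral>x. (\<Sum>j. f j x) \<partial>IM) = c n * sqrt (gram s n n)"
    using sums_If_finite_set[of "{n}" "\<lambda>j. c n * sqrt (gram s n n)"] by (simp add: sums_iff)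
  moreover have "(\<Sum>j. f j x) = gegenbauer_series 0 s c x * ?C n x * ?W x" if "x \<in> space IM" for x
  proof -
    have "\<bar>x\<bar> \<le> 1" using that by (auto simp: space_restrict_space abs_le_iff)
    then have "summable (\<lambda>j. c j * gegenbauer_normalized_D 0 s j x)"
      using le by (intro gegenbauer_series_properties(1)[OF M, of 0]) auto
    then show ?thesis
      unfolding f_def gegenbauer_series_def mult.assoc[of _ "?C n x"]
      by (subst suminf_mult2[symmetric]) auto
  qed
  ultimately show ?thesis
    by (metis (mono_tags, lifting) Bochner_Integration.integral_cong)
qed

lemma gegenbauer_series_AE:
  assumes s: "s \<ge> 0" and v: "v \<in> L2s (-1) 1 s" and M: "summable M"
    and le: "\<And>j x. \<bar>x\<bar> \<le> 1 \<Longrightarrow> \<bar>gegenbauer_coeff s v j * gegenbauer_normalized_D 0 s j x\<bar> \<le> M j"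
  shows "AE x in IM. gegenbauer_series 0 s (gegenbauer_coeff s v) x = v x"
proof -
  let ?C = "gegenbauer (s + 1/2)" and ?W = "weight (-1) 1 s"
  define F where "F = gegenbauer_series 0 s (gegenbauer_coeff s v)"
  have F: "continuous_on {-1..1} F"
    unfolding F_def using le by (intro gegenbauer_series_properties(3)[OF M, of 0]) auto
  note ci = integrable_weight_mult[OF s] continuous_intros continuous_on_gegenbauer F
  have iF: "integrable IM (\<lambda>x. F x * ?W x)" by (intro ci)
  have iFC: "integrable IM (\<lambda>x. F x * ?C n x * ?W x)" for n by (intro ci)
  have ivC: "integrable IM (\<lambda>x. v x * ?C n x * ?W x)" for n
    by (intro integrable_L2s_mult s v continuous_on_gegenbauer)
  have "AE x in IM. F x * ?W x - v x * ?W x = 0"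
  proof (rule gegenbauer_complete)
    show "integrable IM (\<lambda>x. F x * ?W x - v x * ?W x)"
      using iF integrable_L2s_weight[OF s v] by simp
    show "s + 1/2 > 0" using s by simp
    fix n
    have "(\<integral>x. v x * ?C n x * ?W x \<partial>IM)
        = (\<integral>x. sqrt (gram s n n) * (v x * gegenbauer_normalized s n x * ?W x) \<partial>IM)"
      using gram_pos[OF s, of n] by (simp add: gegenbauer_normalized_def L2s_norm_gegenbauer)
    also have "\<dots> = gegenbauer_coeff s v n * sqrt (gram s n n)"
      by (simp add: gegenbauer_coeff_def)
    also have "\<dots> = (\<integral>x. F x * ?C n x * ?W x \<partial>IM)"
      unfolding F_def by (rule gegenbauer_series_coeff[OF s M le, symmetric])
    finally have "(\<integral>x. F x * ?C n x * ?W x - v x * ?C n x * ?W x \<partial>IM) = 0"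
      using iFC ivC by simp
    then show "(\<integral>x. (F x * ?W x - v x * ?W x) * ?C n x \<partial>IM) = 0"
      by (simp add: algebra_simps)
  qed
  then show ?thesis
    using AE_space
  proof eventually_elim
    case (elim x)
    then have "?W x > 0" using weight_pos by (auto simp: space_restrict_space)
    then show ?case using elim by (simp add: F_def)
  qed
qed

lemma gegenbauer_coeff_linear:
  assumes s: "s \<ge> 0" and "u \<in> L2s (-1) 1 s" "v \<in> L2s (-1) 1 s"
  shows "gegenbauer_coeff s (\<lambda>y. c * u y + d * v y) j = c * gegenbauer_coeff s u j + d * gegenbauer_coeff s v j"
proof -
  have n: "gegenbauer_normalized s j = gegenbauer_normalized_D 0 s j" by (auto simp: gegenbauer_normalized_D_0)
  let ?f = "\<lambda>u x. u x * gegenbauer_normalized_D 0 s j x * weight (-1) 1 s x"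
  have i: "integrable IM (?f u)" "integrable IM (?f v)"
    using assms by (auto intro!: integrable_L2s_mult continuous_on_gegenbauer_normalized_D)
  have "gegenbauer_coeff s (\<lambda>y. c * u y + d * v y) j = (\<integral>x. c * ?f u x + d * ?f v x \<partial>IM)"
    unfolding gegenbauer_coeff_def n by (simp add: algebra_simps)
  also have "\<dots> = c * gegenbauer_coeff s u j + d * gegenbauer_coeff s v j"
    using i by (simp add: gegenbauer_coeff_def n)
  finally show ?thesis .
qed

section \<open>Transfer to the interval with end points a and b\<close>

text \<open>The functions \<open>W i\<close> need to be derivatives of each other only on \<open>[a,b]\<close>; the iterated relative
  derivative does not depend on the values outside and is described only inside.\<close>

lemma deriv_on_funpow_eq:
  assumes "a < b" and W: "\<And>i x. i < k \<Longrightarrow> x \<in> {a..b} \<Longrightarrow>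
      (W i has_real_derivative W (Suc i) x) (at x within {a..b})"
  shows "i \<le> k \<Longrightarrow> x \<in> {a..b} \<Longrightarrow> (deriv_on a b ^^ i) (W 0) x = W i x"
proof (induction i arbitrary: x)
  case (Suc i)
  have "((deriv_on a b ^^ i) (W 0) has_vector_derivative W (Suc i) x) (at x within {a..b})"
  proof (rule has_vector_derivative_transform[of x "{a..b}" _ "W i"])
    show "(W i has_vector_derivative W (Suc i) x) (at x within {a..b})"
      using W[of i x] Suc.prems by (simp add: has_real_derivative_iff_has_vector_derivative)
  qed (use Suc in auto)
  then have "deriv_on a b ((deriv_on a b ^^ i) (W 0)) x = W (Suc i) x"
    unfolding deriv_on_def using vector_derivative_within_cbox[OF assms(1), of x] Suc.prems by simp
  then show ?case by simp
qed simp

lemma Ck_of_derivatives: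
  assumes "a < b" and W: "\<And>i x. i < k \<Longrightarrow> x \<in> {a..b} \<Longrightarrow>
      (W i has_real_derivative W (Suc i) x) (at x within {a..b})"
    and cont: "continuous_on {a..b} (W k)"
  shows "W 0 \<in> Ck a b k"
proof -
  have eq: "(deriv_on a b ^^ i) (W 0) x = W i x" if "i \<le> k" "x \<in> {a..b}" for i x
    by (rule deriv_on_funpow_eq[of a b k W, OF assms(1) W]) (use that in auto)
  have d: "W i differentiable_on {a..b}" if "i < k" for i
    unfolding differentiable_on_def
    using W[OF that] unfolding has_real_derivative_iff_has_vector_derivative
    by (blast intro: differentiableI_vector)
  have c: "continuous_on {a..b} (W i)" if "i \<le> k" for i
  proof (cases "i = k")
    case False
    then show ?thesis using that by (intro differentiable_imp_continuous_on d) simp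
  qed (use cont in simp)
  have "(deriv_on a b ^^ i) (W 0) differentiable_on {a..b}" if "i < k" for i
    unfolding differentiable_on_def
  proof
    fix x assume x: "x \<in> {a..b}"
    have "((deriv_on a b ^^ i) (W 0) has_vector_derivative W (Suc i) x) (at x within {a..b})"
    proof (rule has_vector_derivative_transform[of x "{a..b}" _ "W i"])
      show "(W i has_vector_derivative W (Suc i) x) (at x within {a..b})"
        using W[OF that x] by (simp add: has_real_derivative_iff_has_vector_derivative)
    qed (use x that in \<open>auto intro: eq\<close>)
    then show "(deriv_on a b ^^ i) (W 0) differentiable at x within {a..b}"
      by (rule differentiableI_vector)
  qed
  moreover have "continuous_on {a..b} ((deriv_on a b ^^ i) (W 0))" if "i \<le> k" for i
    using c[OF that] by (rule continuous_on_eq) (simp add: eq that)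
  ultimately show ?thesis by (simp add: Ck_def)
qed

text \<open>The exceptional set is the image of a null set under a differentiable map, hence a null set.\<close>

lemma AE_affine_from_ref:
  fixes a b :: real
  assumes "a < b" and "AE \<xi> in lebesgue_on {-1<..<1}. P (a + (b - a) * (\<xi> + 1) / 2)"
  shows "AE x in lebesgue_on {a<..<b}. P x"
proof -
  define \<psi> where "\<psi> = (\<lambda>\<xi>::real. a + (b - a) * (\<xi> + 1) / 2)"
  have "AE \<xi> in lebesgue. \<xi> \<in> {-1<..<1} \<longrightarrow> P (\<psi> \<xi>)"
    using assms(2) by (subst (asm) AE_restrict_space_iff) (auto simp: \<psi>_def)
  then obtain N where N: "negligible N" and NP: "{\<xi>. \<not> (\<xi> \<in> {-1<..<1} \<longrightarrow> P (\<psi> \<xi>))} \<subseteq> N"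
    unfolding eventually_ae_filter_negligible by blast
  have "(\<psi> has_vector_derivative (b - a) / 2) (at \<xi> within N)" for \<xi>
    unfolding has_real_derivative_iff_has_vector_derivative[symmetric] \<psi>_def
    by (auto intro!: derivative_eq_intros)
  then have "\<psi> differentiable_on N"
    unfolding differentiable_on_def by (blast intro: differentiableI_vector)
  then have "negligible (\<psi> ` N)"
    by (rule negligible_differentiable_image_negligible[OF order_refl N])
  moreover have "{x. \<not> (x \<in> {a<..<b} \<longrightarrow> P x)} \<subseteq> \<psi> ` N"
  proof
    fix x assume x: "x \<in> {x. \<not> (x \<in> {a<..<b} \<longrightarrow> P x)}"
    define \<xi> where "\<xi> = 2 * (x - a) / (b - a) - 1"
    have "(b - a) * (\<xi> + 1) = 2 * (x - a)" using assms(1) by (simp add: \<xi>_def)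
    then have "x = \<psi> \<xi>" by (simp add: \<psi>_def field_simps)
    moreover have "-1 < \<xi>" "\<xi> < 1" using assms(1) x by (auto simp: \<xi>_def field_simps)
    ultimately show "x \<in> \<psi> ` N" using x NP by auto
  qed
  ultimately have "AE x in lebesgue. x \<in> {a<..<b} \<longrightarrow> P x"
    unfolding eventually_ae_filter_negligible by blast
  then show ?thesis by (subst AE_restrict_space_iff) auto
qed

theorem theorem4p14:
  fixes a b s r :: real and k :: nat
  assumes "a < b" and "s \<ge> 0" and "r > 2 * real k + s + 1"
  shows "\<exists>J :: (real \<Rightarrow> real) \<Rightarrow> (real \<Rightarrow> real).
    (\<forall>v\<in>Hrs a b r s. J v \<in> Ck a b k \<and> (AE x in lebesgue_on {a<..<b}. J v x = v x)) \<and>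
    (\<forall>u\<in>Hrs a b r s. \<forall>v\<in>Hrs a b r s. \<forall>c d :: real. \<forall>x\<in>{a..b}.
        J (\<lambda>y. c * u y + d * v y) x = c * J u x + d * J v x) \<and>
    (\<exists>C. \<forall>v\<in>Hrs a b r s. Ck_norm a b k (J v) \<le> C * Hrs_norm a b r s v)"
proof -
  \<comment> \<open>The growth exponent of the \<open>k\<close>-th derivatives; the hypothesis on \<open>r\<close> says \<open>2 * E < r - 1/2\<close>.\<close>
  define E where "E = real k + s/2 + 1/4"
  define q where "q = (\<lambda>j::nat. 1 + (real j)\<^sup>2)"
  define L where "L = 2 / (b - a)"
  have L: "L > 0" "L * (b - a) = 2" using assms(1) by (auto simp: L_def divide_eq_eq)
  define \<phi> where "\<phi> = (\<lambda>x. L * (x - a) - 1)"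
  define co where "co = (\<lambda>v. gegenbauer_coeff s (to_ref a b v))"
  \<comment> \<open>The candidate for the \<open>i\<close>-th derivative of the image of \<open>v\<close>; the factor \<open>L ^ i\<close> comes from the
    chain rule for the affine map \<open>\<phi>\<close> onto \<open>[-1,1]\<close>.\<close>
  define W where "W = (\<lambda>v i x. L ^ i * gegenbauer_series i s (co v) (\<phi> x))"
  obtain K where K: "K \<ge> 0" and le: "\<And>i j x. i \<le> k \<Longrightarrow> \<bar>x\<bar> \<le> 1 \<Longrightarrow>
      \<bar>gegenbauer_normalized_D i s j x\<bar> \<le> K * q j powr E"
    using gegenbauer_series_majorant[OF assms(2), of k] unfolding q_def E_def by blast
  have "2 * E < r - 1/2" using assms(3) by (simp add: E_def)
  then obtain S where S: "\<And>v. v \<in> Hrs_ref r s \<Longrightarrow>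
      summable (\<lambda>j. \<bar>gegenbauer_coeff s v j\<bar> * q j powr E)"
      "\<And>v. v \<in> Hrs_ref r s \<Longrightarrow>
      (\<Sum>j. \<bar>gegenbauer_coeff s v j\<bar> * q j powr E) \<le> S * Hrs_ref_norm r s v"
    using Hrs_ref_coeff_summable[of "2 * E" r s] unfolding q_def by auto
  define M where "M = (\<lambda>v j. K * (\<bar>co v j\<bar> * q j powr E))"
  have M: "summable (M v)" and Msum: "suminf (M v) \<le> K * S * Hrs_norm a b r s v"
    if v: "v \<in> Hrs a b r s" for v
  proof -
    have v': "to_ref a b v \<in> Hrs_ref r s" using v by (simp add: Hrs_def)
    show "summable (M v)" unfolding M_def co_def by (intro summable_mult S(1) v')
    have "suminf (M v) = K * (\<Sum>j. \<bar>co v j\<bar> * q j powr E)"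
      unfolding M_def co_def by (intro suminf_mult S(1) v')
    also have "\<dots> \<le> K * (S * Hrs_norm a b r s v)"
      unfolding co_def Hrs_norm_def using S(2)[OF v'] K by (intro mult_left_mono)
    finally show "suminf (M v) \<le> K * S * Hrs_norm a b r s v" by simp
  qed
  have Mle: "\<bar>co v j * gegenbauer_normalized_D i s j x\<bar> \<le> M v j" if "i \<le> k" "\<bar>x\<bar> \<le> 1" for v i j x
    using mult_left_mono[OF le[OF that, of j], of "\<bar>co v j\<bar>"] by (simp add: M_def abs_mult mult_ac)
  have ser_prop:
    "i \<le> k \<Longrightarrow> \<bar>x\<bar> \<le> 1 \<Longrightarrow> summable (\<lambda>j. co v j * gegenbauer_normalized_D i s j x)"
    "i \<le> k \<Longrightarrow> \<bar>x\<bar> \<le> 1 \<Longrightarrow> \<bar>gegenbauer_series i s (co v) x\<bar> \<le> suminf (M v)"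
    "i \<le> k \<Longrightarrow> continuous_on {-1..1} (gegenbauer_series i s (co v))"
    "i < k \<Longrightarrow> \<bar>x\<bar> \<le> 1 \<Longrightarrow> (gegenbauer_series i s (co v) has_real_derivative
        gegenbauer_series (Suc i) s (co v) x) (at x within {-1..1})"
    if v: "v \<in> Hrs a b r s" for v i x
    by (rule gegenbauer_series_properties[OF M[OF v] Mle]; assumption)+
  have \<phi>: "\<bar>\<phi> x\<bar> \<le> 1" if "x \<in> {a..b}" for x
  proof -
    have "0 \<le> L * (x - a)" using that L(1) by simp
    moreover have "L * (x - a) \<le> L * (b - a)" using that L(1) by (intro mult_left_mono) auto
    ultimately show ?thesis unfolding \<phi>_def L(2) by (simp add: abs_le_iff)
  qed
  have \<phi>D: "(\<phi> has_real_derivative L) (at x within A)" for x A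
    unfolding \<phi>_def by (auto intro!: derivative_eq_intros)
  have WD: "(W v i has_real_derivative W v (Suc i) x) (at x within {a..b})"
    if v: "v \<in> Hrs a b r s" and "i < k" "x \<in> {a..b}" for v i x
  proof -
    have "(gegenbauer_series i s (co v) has_real_derivative gegenbauer_series (Suc i) s (co v) (\<phi> x))
        (at (\<phi> x) within \<phi> ` {a..b})"
      using \<phi> that
      by (intro has_field_derivative_subset[OF ser_prop(4)[OF v]]) (auto simp: abs_le_iff)
    from DERIV_image_chain[OF this \<phi>D]
    have "((\<lambda>x. L ^ i * gegenbauer_series i s (co v) (\<phi> x)) has_real_derivative
        L ^ i * (gegenbauer_series (Suc i) s (co v) (\<phi> x) * L)) (at x within {a..b})"
      unfolding o_def by (rule DERIV_cmult)
    then show ?thesis by (simp add: W_def mult_ac)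
  qed
  have Wcont: "continuous_on {a..b} (W v k)" if v: "v \<in> Hrs a b r s" for v
    unfolding W_def
    using \<phi> by (intro continuous_intros continuous_on_compose2[OF ser_prop(3)[OF v]] DERIV_continuous_on[OF \<phi>D])
      (auto simp: abs_le_iff)
  have Wle: "\<bar>W v i x\<bar> \<le> L ^ i * (K * S * Hrs_norm a b r s v)"
    if v: "v \<in> Hrs a b r s" and "i \<le> k" "x \<in> {a..b}" for v i x
  proof -
    have "\<bar>gegenbauer_series i s (co v) (\<phi> x)\<bar> \<le> K * S * Hrs_norm a b r s v"
      using ser_prop(2)[OF v that(2) \<phi>[OF that(3)]] Msum[OF v] by linarith
    then show ?thesis using L by (simp add: W_def abs_mult)
  qed
  have 1: "W v 0 \<in> Ck a b k" if "v \<in> Hrs a b r s" for v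
    using that by (intro Ck_of_derivatives[of a b k "W v"] assms(1) WD Wcont)
  have 2: "AE x in lebesgue_on {a<..<b}. W v 0 x = v x" if v: "v \<in> Hrs a b r s" for v
  proof (rule AE_affine_from_ref[OF assms(1)])
    have "to_ref a b v \<in> L2s (-1) 1 s" using v by (simp add: Hrs_def Hrs_ref_def)
    from gegenbauer_series_AE[OF assms(2) this M[OF v]] Mle[of 0]
    have "AE \<xi> in IM. gegenbauer_series 0 s (co v) \<xi> = to_ref a b v \<xi>" by (simp add: co_def)
    moreover have "\<phi> (a + (b - a) * (\<xi> + 1) / 2) = \<xi>" for \<xi>
    proof -
      have "\<phi> (a + (b - a) * (\<xi> + 1) / 2) = (L * (b - a)) * (\<xi> + 1) / 2 - 1" by (simp add: \<phi>_def)
      then show ?thesis unfolding L(2) by (simp add: field_simps)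
    qed
    ultimately show "AE \<xi> in IM. W v 0 (a + (b - a) * (\<xi> + 1) / 2) = v (a + (b - a) * (\<xi> + 1) / 2)"
      by (simp add: W_def to_ref_def)
  qed
  have 3: "W (\<lambda>y. c * u y + d * v y) 0 x = c * W u 0 x + d * W v 0 x"
    if u: "u \<in> Hrs a b r s" and v: "v \<in> Hrs a b r s" and x: "x \<in> {a..b}" for u v c d x
  proof -
    have co: "co (\<lambda>y. c * u y + d * v y) j = c * co u j + d * co v j" for j
      using gegenbauer_coeff_linear[OF assms(2), of "to_ref a b u" "to_ref a b v" c d j] u v
      by (simp add: co_def Hrs_def Hrs_ref_def to_ref_def)
    let ?f = "\<lambda>w j. co w j * gegenbauer_normalized_D 0 s j (\<phi> x)"
    have sm: "summable (?f u)" "summable (?f v)"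
      using ser_prop(1)[OF u _ \<phi>[OF x]] ser_prop(1)[OF v _ \<phi>[OF x]] by auto
    have "(\<Sum>j. co (\<lambda>y. c * u y + d * v y) j * gegenbauer_normalized_D 0 s j (\<phi> x)) = (\<Sum>j. c * ?f u j + d * ?f v j)"
      by (simp add: co algebra_simps)
    also have "\<dots> = c * suminf (?f u) + d * suminf (?f v)"
      using sm by (simp add: suminf_add[symmetric] suminf_mult summable_mult)
    finally show ?thesis by (simp add: W_def gegenbauer_series_def)
  qed
  have 4: "Ck_norm a b k (W v 0) \<le> ((1 + L ^ k) * (K * S)) * Hrs_norm a b r s v"
    if v: "v \<in> Hrs a b r s" for v
  proof -
    have eq: "(deriv_on a b ^^ k) (W v 0) x = W v k x" if "x \<in> {a..b}" for x
      using that v by (intro deriv_on_funpow_eq[of a b k "W v"] assms(1) WD) auto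
    have "sup_norm_on a b (W v 0) \<le> L ^ 0 * (K * S * Hrs_norm a b r s v)"
      unfolding sup_norm_on_def using assms(1) Wle[OF v, of 0] by (intro cSUP_least) auto
    moreover have "sup_norm_on a b ((deriv_on a b ^^ k) (W v 0)) \<le> L ^ k * (K * S * Hrs_norm a b r s v)"
      unfolding sup_norm_on_def using assms(1) Wle[OF v, of k] by (intro cSUP_least) (auto simp: eq)
    ultimately show ?thesis unfolding Ck_norm_def by (simp add: algebra_simps)
  qed
  show ?thesis
  proof (intro exI[of _ "\<lambda>v. W v 0"] conjI ballI allI)
    show "\<exists>C. \<forall>v\<in>Hrs a b r s. Ck_norm a b k (W v 0) \<le> C * Hrs_norm a b r s v"
      using 4 by blast
  qed (rule 1 2 3; assumption)+
qed

end
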